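(* The class $\mathcal{A}=\mathcal{A}^3_{\infty,0,7,8}$ satisfies both an unlabeled and a labeled 0--1 law: for every first-order sentence $\phi$ in the language $\mathcal{L}=\{R_1,R_2,R_3\}$, the limit $\lim_{n\to\infty}\mathfrak{m}_{\mathcal{A},\phi}(n)$ exists and lies in $\{0,1\}$, both when $\mathfrak{m}_{\mathcal{A},\phi}(n)$ is the proportion of isomorphism classes of $n$-point members of $\mathcal{A}$ satisfying $\phi$ (unlabeled) and when it is the proportion of members of $\mathcal{A}$ with universe $\{1,\dots,n\}$ satisfying $\phi$ (labeled). Moreover, the almost sure theory of $\mathcal{A}^3_{\infty,0,7,8}$ (the set of sentences $\phi$ whose limit is $1$) differs from the generic theory, i.e. from the complete first-order theory of $\Gamma^3_{\infty,0,7,8}$.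
   Context: All metric spaces considered have all distances between distinct points in $\{1,2,3\}$; they are viewed as $\mathcal{L}$-structures with $\mathcal{L}=\{R_1,R_2,R_3\}$, where $R_i(x,y)$ means $d(x,y)=i$, and isomorphism means isometry. For three distinct points, the triangle they form is the multiset of their three pairwise distances. $\mathcal{A}^3_{\infty,0,7,8}$ is the class of finite metric spaces with distances in $\{1,2,3\}$ in which every triangle is one of $\{1,1,2\}$, $\{1,2,3\}$, $\{2,2,2\}$ (equivalently: containing no triangle of odd perimeter, none of perimeter at least $8$, and none of the form $(1,k,k)$). This class is a Fraïssé (amalgamation) class, and $\Gamma^3_{\infty,0,7,8}$ denotes its Fraïssé limit, the countable homogeneous metric space whose finite substructures are exactly the members of the class (it consists of two countably infinite parts, distances $2$ within a part, and each point at distance $3$ from exactly one point of the other part and distance $1$ from all others). *)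

theory Defs
  imports "HOL-Analysis.Analysis" "HOL-Library.Multiset"
begin

section \<open>First-order logic over three binary distance relations\<close>

datatype rsym = R1 | R2 | R3

fun rdist :: "rsym \<Rightarrow> real" where
  "rdist R1 = 1"
| "rdist R2 = 2"
| "rdist R3 = 3"

text \<open>Variables are named by natural numbers; the remaining connectives and the universal
  quantifier are definable.\<close>

datatype fm =
    Equal nat nat
  | Rel rsym nat nat
  | Neg fm
  | Conj fm fm
  | Ex nat fm

fun free_vars :: "fm \<Rightarrow> nat set" where
  "free_vars (Equal x y) = {x, y}"
| "free_vars (Rel r x y) = {x, y}"
| "free_vars (Neg \<phi>) = free_vars \<phi>"
| "free_vars (Conj \<phi> \<psi>) = free_vars \<phi> \<union> free_vars \<psi>"
| "free_vars (Ex x \<phi>) = free_vars \<phi> - {x}"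

definition sentence :: "fm \<Rightarrow> bool" where
  "sentence \<phi> \<longleftrightarrow> free_vars \<phi> = {}"

fun sat :: "'a set \<Rightarrow> ('a \<Rightarrow> 'a \<Rightarrow> real) \<Rightarrow> (nat \<Rightarrow> 'a) \<Rightarrow> fm \<Rightarrow> bool" where
  "sat M d e (Equal x y) \<longleftrightarrow> e x = e y"
| "sat M d e (Rel r x y) \<longleftrightarrow> d (e x) (e y) = rdist r"
| "sat M d e (Neg \<phi>) \<longleftrightarrow> \<not> sat M d e \<phi>"
| "sat M d e (Conj \<phi> \<psi>) \<longleftrightarrow> sat M d e \<phi> \<and> sat M d e \<psi>"
| "sat M d e (Ex x \<phi>) \<longleftrightarrow> (\<exists>a\<in>M. sat M d (e(x := a)) \<phi>)"

text \<open>Only used for sentences, whose truth value does not depend on the valuation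
  (see \<open>models_sentence\<close> below), so it is harmless that the valuation is not restricted
  to \<open>M\<close>; this also gives the right meaning when \<open>M\<close> is empty.\<close>

definition models :: "'a set \<Rightarrow> ('a \<Rightarrow> 'a \<Rightarrow> real) \<Rightarrow> fm \<Rightarrow> bool" where
  "models M d \<phi> \<longleftrightarrow> (\<forall>e. sat M d e \<phi>)"

definition complete_theory :: "'a set \<Rightarrow> ('a \<Rightarrow> 'a \<Rightarrow> real) \<Rightarrow> fm set" where
  "complete_theory M d = {\<phi>. sentence \<phi> \<and> models M d \<phi>}"

lemma sat_cong:
  "(\<And>x. x \<in> free_vars \<phi> \<Longrightarrow> e x = e' x) \<Longrightarrow> sat M d e \<phi> = sat M d e' \<phi>"
proof (induction \<phi> arbitrary: e e')
  case (Ex x \<phi>)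
  have "sat M d (e(x := a)) \<phi> = sat M d (e'(x := a)) \<phi>" for a
    by (rule Ex.IH) (use Ex.prems in auto)
  then show ?case by simp
next
  case (Conj \<phi> \<psi>)
  have "sat M d e \<phi> = sat M d e' \<phi>" by (rule Conj.IH) (use Conj.prems in auto)
  moreover have "sat M d e \<psi> = sat M d e' \<psi>" by (rule Conj.IH) (use Conj.prems in auto)
  ultimately show ?case by simp
next
  case (Neg \<phi>)
  have "sat M d e \<phi> = sat M d e' \<phi>" by (rule Neg.IH) (use Neg.prems in auto)
  then show ?case by simp
qed simp_all

lemma models_sentence:
  assumes "sentence \<phi>"
  shows "models M d \<phi> \<longleftrightarrow> sat M d e \<phi>"
proof -
  have eq: "sat M d e' \<phi> = sat M d e \<phi>" for e'
    by (rule sat_cong) (use assms in \<open>simp add: sentence_def\<close>)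
  show ?thesis unfolding models_def using eq by (intro iffI allI) (auto simp only:)
qed


section \<open>Isometries and the amalgamation class\<close>

definition isometry :: "'a set \<Rightarrow> ('a \<Rightarrow> 'a \<Rightarrow> real) \<Rightarrow> 'b set \<Rightarrow> ('b \<Rightarrow> 'b \<Rightarrow> real) \<Rightarrow> ('a \<Rightarrow> 'b) \<Rightarrow> bool"
  where "isometry M d N d' f \<longleftrightarrow> bij_betw f M N \<and> (\<forall>x\<in>M. \<forall>y\<in>M. d' (f x) (f y) = d x y)"

definition isometric :: "'a set \<Rightarrow> ('a \<Rightarrow> 'a \<Rightarrow> real) \<Rightarrow> 'b set \<Rightarrow> ('b \<Rightarrow> 'b \<Rightarrow> real) \<Rightarrow> bool" where
  "isometric M d N d' \<longleftrightarrow> (\<exists>f. isometry M d N d' f)"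

definition class_A :: "'a set \<Rightarrow> ('a \<Rightarrow> 'a \<Rightarrow> real) \<Rightarrow> bool" where
  "class_A M d \<longleftrightarrow> finite M \<and> Metric_space M d \<and>
     (\<forall>x\<in>M. \<forall>y\<in>M. x \<noteq> y \<longrightarrow> d x y \<in> {1, 2, 3}) \<and>
     (\<forall>x\<in>M. \<forall>y\<in>M. \<forall>z\<in>M. x \<noteq> y \<and> y \<noteq> z \<and> x \<noteq> z \<longrightarrow>
        {#d x y, d y z, d x z#} \<in> {{#1, 1, 2#}, {#1, 2, 3#}, {#2, 2, 2#}})"


section \<open>Labeled and unlabeled 0--1 laws\<close>

text \<open>In what follows \<open>K\<close> is a class of finite metric spaces closed under isometry. As every
  finite space is isometric to one on a set of natural numbers, it suffices to represent \<open>K\<close>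
  by its members with carrier contained in \<open>\<nat>\<close>.\<close>

type_synonym metric_class = "nat set \<Rightarrow> (nat \<Rightarrow> nat \<Rightarrow> real) \<Rightarrow> bool"

text \<open>The distance function is normalised to \<open>0\<close> outside \<open>{1..n}\<close> so that each
  metric on \<open>{1..n}\<close> is counted exactly once.\<close>

definition labeled :: "metric_class \<Rightarrow> nat \<Rightarrow> (nat \<Rightarrow> nat \<Rightarrow> real) set" where
  "labeled K n = {d. K {1..n} d \<and> (\<forall>x y. x \<notin> {1..n} \<or> y \<notin> {1..n} \<longrightarrow> d x y = 0)}"

definition isometric_rel :: "nat \<Rightarrow> ((nat \<Rightarrow> nat \<Rightarrow> real) \<times> (nat \<Rightarrow> nat \<Rightarrow> real)) set" where
  "isometric_rel n = {(d, d'). isometric {1..n} d {1..n} d'}"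

definition unlabeled :: "metric_class \<Rightarrow> nat \<Rightarrow> (nat \<Rightarrow> nat \<Rightarrow> real) set set" where
  "unlabeled K n = labeled K n // (isometric_rel n \<inter> labeled K n \<times> labeled K n)"

definition labeled_proportion :: "metric_class \<Rightarrow> fm \<Rightarrow> nat \<Rightarrow> real" where
  "labeled_proportion K \<phi> n =
     real (card {d \<in> labeled K n. models {1..n} d \<phi>}) / real (card (labeled K n))"

definition unlabeled_proportion :: "metric_class \<Rightarrow> fm \<Rightarrow> nat \<Rightarrow> real" where
  "unlabeled_proportion K \<phi> n =
     real (card {C \<in> unlabeled K n. \<forall>d\<in>C. models {1..n} d \<phi>}) / real (card (unlabeled K n))"

definition zero_one_law :: "(fm \<Rightarrow> nat \<Rightarrow> real) \<Rightarrow> bool" where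
  "zero_one_law m \<longleftrightarrow> (\<forall>\<phi>. sentence \<phi> \<longrightarrow> (\<exists>l\<in>{0, 1}. m \<phi> \<longlonglongrightarrow> l))"

definition almost_sure_theory :: "(fm \<Rightarrow> nat \<Rightarrow> real) \<Rightarrow> fm set" where
  "almost_sure_theory m = {\<phi>. sentence \<phi> \<and> m \<phi> \<longlonglongrightarrow> 1}"

lemma finite_labeled: "finite (labeled class_A n)"
proof (rule finite_subset)
  let ?I = "{1..n} \<times> {1..n}"
  let ?S = "{f :: nat \<times> nat \<Rightarrow> real. \<forall>p. (p \<in> ?I \<longrightarrow> f p \<in> {0,1,2,3}) \<and> (p \<notin> ?I \<longrightarrow> f p = 0)}"
  show "finite (curry ` ?S)" by (intro finite_imageI finite_set_of_finite_funs) auto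
  show "labeled class_A n \<subseteq> curry ` ?S"
  proof
    fix d assume d: "d \<in> labeled class_A n"
    then interpret Metric_space "{1..n}" d by (simp add: labeled_def class_A_def)
    have I: "d x y \<in> {0,1,2,3}" if "x \<in> {1..n}" "y \<in> {1..n}" for x y
    proof (cases "x = y")
      case True
      then show ?thesis using that by simp
    next
      case False
      then show ?thesis using d that unfolding labeled_def class_A_def mem_Collect_eq by blast
    qed
    have Z: "d x y = 0" if "x \<notin> {1..n} \<or> y \<notin> {1..n}" for x y
      using d that unfolding labeled_def by blast
    have mem: "(\<lambda>p. d (fst p) (snd p)) \<in> ?S"
      unfolding mem_Collect_eq mem_Times_iff
    proof (intro allI conjI impI)
      fix p
      show "d (fst p) (snd p) \<in> {0,1,2,3}" if "fst p \<in> {1..n} \<and> snd p \<in> {1..n}"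
        using I that by blast
      show "d (fst p) (snd p) = 0" if "\<not> (fst p \<in> {1..n} \<and> snd p \<in> {1..n})"
        using Z that by blast
    qed
    have "d = curry (\<lambda>p. d (fst p) (snd p))" by (simp add: curry_def)
    then show "d \<in> curry ` ?S" using mem by (rule image_eqI)
  qed
qed


section \<open>Fraisse limits\<close>

definition homogeneous :: "'a set \<Rightarrow> ('a \<Rightarrow> 'a \<Rightarrow> real) \<Rightarrow> bool" where
  "homogeneous M d \<longleftrightarrow>
     (\<forall>F f. finite F \<and> F \<subseteq> M \<and> f ` F \<subseteq> M \<and> isometry F d (f ` F) d f \<longrightarrow>
        (\<exists>g. isometry M d M d g \<and> (\<forall>x\<in>F. g x = f x)))"

definition fraisse_limit :: "metric_class \<Rightarrow> 'a set \<Rightarrow> ('a \<Rightarrow> 'a \<Rightarrow> real) \<Rightarrow> bool" where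
  "fraisse_limit K M d \<longleftrightarrow> Metric_space M d \<and> countable M \<and> homogeneous M d \<and>
     (\<forall>F. finite F \<and> F \<subseteq> M \<longrightarrow> (\<exists>N e. K N e \<and> isometric N e F d)) \<and>
     (\<forall>N e. K N e \<longrightarrow> (\<exists>F. finite F \<and> F \<subseteq> M \<and> isometric N e F d))"

text \<open>The Fraisse limit of \<open>class_A\<close> exists: here is a copy of it on \<open>nat \<times> bool\<close>.\<close>

definition gamma_dist :: "nat \<times> bool \<Rightarrow> nat \<times> bool \<Rightarrow> real" where
  "gamma_dist p q =
     (if snd p = snd q then (if fst p = fst q then 0 else 2)
      else (if fst p = fst q then 3 else 1))"

lemma Metric_space_gamma: "Metric_space UNIV gamma_dist"
proof
  fix x y z
  show "0 \<le> gamma_dist x y" by (simp add: gamma_dist_def)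
  show "gamma_dist x y = gamma_dist y x" 
    by (cases "fst x = fst y"; cases "snd x = snd y") (simp_all add: gamma_dist_def)
  show "gamma_dist x y = 0 \<longleftrightarrow> x = y" by (simp add: gamma_dist_def prod_eq_iff)
  show "gamma_dist x z \<le> gamma_dist x y + gamma_dist y z"
    by (cases "fst x = fst y"; cases "fst y = fst z"; cases "snd x = snd y"; cases "snd y = snd z")
      (simp_all add: gamma_dist_def)
qed

lemma Metric_space_subset: "Metric_space M d \<Longrightarrow> N \<subseteq> M \<Longrightarrow> Metric_space N d"
  by (rule Metric_space.subspace)

lemma class_A_gamma: "finite F \<Longrightarrow> class_A F gamma_dist"
  unfolding class_A_def
proof (intro conjI ballI impI)
  show "Metric_space F gamma_dist"
    using Metric_space_subset[OF Metric_space_gamma, of F] by simp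
next
  fix x y :: "nat \<times> bool" assume "x \<noteq> y"
  then show "gamma_dist x y \<in> {1, 2, 3}" by (simp add: gamma_dist_def prod_eq_iff)
next
  fix x y z :: "nat \<times> bool" assume "x \<noteq> y \<and> y \<noteq> z \<and> x \<noteq> z"
  then show "{#gamma_dist x y, gamma_dist y z, gamma_dist x z#}
      \<in> {{#1, 1, 2#}, {#1, 2, 3#}, {#2, 2, 2#}}"
    by (cases x; cases y; cases z) (auto simp: gamma_dist_def add_mset_commute)
qed

lemma class_A_transfer:
  assumes "class_A F d" "bij_betw f N F"
  shows "class_A N (\<lambda>x y. if x \<in> N \<and> y \<in> N then d (f x) (f y) else 0)"
proof -
  interpret Metric_space F d using assms by (simp add: class_A_def)
  have mem: "f x \<in> F" if "x \<in> N" for x using that assms(2) by (auto simp: bij_betw_def)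
  have inj: "f x = f y \<longleftrightarrow> x = y" if "x \<in> N" "y \<in> N" for x y
    using that assms(2) by (auto simp: bij_betw_def inj_on_def)
  have "Metric_space N (\<lambda>x y. if x \<in> N \<and> y \<in> N then d (f x) (f y) else 0)"
  proof
    fix x y
    show "(if x \<in> N \<and> y \<in> N then d (f x) (f y) else 0)
        = (if y \<in> N \<and> x \<in> N then d (f y) (f x) else 0)"
      using commute[of "f x" "f y"] by presburger
  qed (simp_all add: mem inj triangle)
  moreover have "finite N" using assms(1) bij_betw_finite[OF assms(2)] by (simp add: class_A_def)
  moreover have "d (f x) (f y) \<in> {1, 2, 3}" if "x \<in> N" "y \<in> N" "x \<noteq> y" for x y
    using assms(1) mem[OF that(1)] mem[OF that(2)] inj[OF that(1,2)] that(3)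
    unfolding class_A_def by blast
  moreover have "{#d (f x) (f y), d (f y) (f z), d (f x) (f z)#}
      \<in> {{#1, 1, 2#}, {#1, 2, 3#}, {#2, 2, 2#}}"
    if "x \<in> N" "y \<in> N" "z \<in> N" "x \<noteq> y \<and> y \<noteq> z \<and> x \<noteq> z" for x y z
  proof -
    have "f x \<noteq> f y \<and> f y \<noteq> f z \<and> f x \<noteq> f z" using that by (simp add: inj)
    then show ?thesis
      using assms(1) mem[OF that(1)] mem[OF that(2)] mem[OF that(3)]
      unfolding class_A_def by blast
  qed
  ultimately show ?thesis
    unfolding class_A_def by (simp only: if_True simp_thms cong: ball_cong) blast
qed

lemma extend_nat_perm:
  fixes f :: "nat \<Rightarrow> nat"
  assumes "finite A" "inj_on f A"
  shows "\<exists>g. bij g \<and> (\<forall>x\<in>A. g x = f x)"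
proof -
  have "infinite (- A)" "infinite (- (f ` A))"
    using assms by (simp_all add: Compl_eq_Diff_UNIV)
  then obtain h where h: "bij_betw h (- A) (- (f ` A))"
    by (metis bij_betw_trans bij_betw_inv countableE_infinite uncountable_def countableI_type)
  let ?g = "\<lambda>x. if x \<in> A then f x else h x"
  have "bij_betw ?g A (f ` A)"
    using assms(2) by (auto simp: bij_betw_def inj_on_def)
  moreover have "bij_betw ?g (- A) (- (f ` A))"
    using h by (subst bij_betw_cong[of _ _ h]) auto
  ultimately have "bij_betw ?g (A \<union> - A) (f ` A \<union> - (f ` A))"
    by (rule bij_betw_combine) auto
  then show ?thesis by (intro exI[of _ ?g]) (auto simp: Un_commute)
qed

lemma homogeneous_gamma: "homogeneous UNIV gamma_dist"
  unfolding homogeneous_def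
proof (intro allI impI, elim conjE)
  fix F and f :: "nat \<times> bool \<Rightarrow> nat \<times> bool"
  assume fin: "finite F" and iso: "isometry F gamma_dist (f ` F) gamma_dist f"
  have d: "gamma_dist (f p) (f q) = gamma_dist p q" if "p \<in> F" "q \<in> F" for p q
    using iso that by (auto simp: isometry_def)
  have s: "snd (f p) = snd (f q) \<longleftrightarrow> snd p = snd q"
    and t: "fst (f p) = fst (f q) \<longleftrightarrow> fst p = fst q" if "p \<in> F" "q \<in> F" for p q
    using d[OF that] by (auto simp: gamma_dist_def split: if_splits)
  define k where "k m = fst (f (SOME p. p \<in> F \<and> fst p = m))" for m
  have k: "k (fst p) = fst (f p)" if "p \<in> F" for p
  proof -
    have "(SOME q. q \<in> F \<and> fst q = fst p) \<in> F \<and> fst (SOME q. q \<in> F \<and> fst q = fst p) = fst p"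
      by (rule someI[of "\<lambda>q. q \<in> F \<and> fst q = fst p" p]) (use that in auto)
    then show ?thesis unfolding k_def using t that by blast
  qed
  have "inj_on k (fst ` F)"
  proof (rule inj_onI)
    fix m n assume "m \<in> fst ` F" "n \<in> fst ` F" and eq: "k m = k n"
    then obtain p q where pq: "p \<in> F" "m = fst p" "q \<in> F" "n = fst q" by blast
    then show "m = n" using eq t k by metis
  qed
  then obtain g where g: "bij g" "\<And>x. x \<in> fst ` F \<Longrightarrow> g x = k x"
    using extend_nat_perm fin by (metis finite_imageI)
  obtain c where c: "\<And>p. p \<in> F \<Longrightarrow> snd (f p) = (snd p \<noteq> c)"
  proof (cases "F = {}")
    case False
    then obtain p0 where p0: "p0 \<in> F" by auto
    show ?thesis by (rule that[of "snd (f p0) \<noteq> snd p0"]) (use s p0 in blast)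
  qed (use that in auto)
  define h where "h = map_prod g (\<lambda>b. b \<noteq> c)"
  have "bij (\<lambda>b. b \<noteq> c)" by (rule bijI) (auto simp: inj_def surj_def)
  then have "bij h" unfolding h_def using g(1)
    by (simp add: bij_def prod.inj_map map_prod_surj)
  then have "isometry UNIV gamma_dist UNIV gamma_dist h"
    using g(1) by (auto simp: isometry_def gamma_dist_def h_def bij_def inj_eq)
  moreover have "\<forall>x\<in>F. h x = f x"
  proof
    fix x assume x: "x \<in> F"
    then have "g (fst x) = fst (f x)" using g(2)[of "fst x"] k[of x] by simp
    then show "h x = f x" using c[OF x] by (simp add: h_def prod_eq_iff)
  qed
  ultimately show "\<exists>h. isometry UNIV gamma_dist UNIV gamma_dist h \<and> (\<forall>x\<in>F. h x = f x)"
    by blast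
qed

lemma dist_sum_cases:
  fixes a b c :: real
  assumes "a = 1 \<or> a = 2 \<or> a = 3" "b = 1 \<or> b = 2 \<or> b = 3" "c = 1 \<or> c = 2 \<or> c = 3"
    and "a + (b + c) = 4 \<or> a + (b + c) = 6"
  shows "(a = 1 \<and> b = 1 \<and> c = 2) \<or> (a = 1 \<and> b = 2 \<and> c = 1)
      \<or> (a = 2 \<and> b = 1 \<and> c = 1) \<or> (a = 2 \<and> b = 2 \<and> c = 2)
      \<or> (a = 1 \<and> b = 2 \<and> c = 3) \<or> (a = 1 \<and> b = 3 \<and> c = 2)
      \<or> (a = 2 \<and> b = 1 \<and> c = 3) \<or> (a = 2 \<and> b = 3 \<and> c = 1)
      \<or> (a = 3 \<and> b = 1 \<and> c = 2) \<or> (a = 3 \<and> b = 2 \<and> c = 1)"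
  by (insert assms) (elim disjE; simp)

lemma class_A_embeds_gamma:
  fixes N :: "nat set"
  assumes "class_A N e"
  shows "\<exists>F. finite F \<and> isometric N e F gamma_dist"
proof (cases "N = {}")
  case True
  then show ?thesis
    by (intro exI[of _ "{}"]) (auto simp: isometric_def isometry_def bij_betw_def)
next
  case False
  then obtain p where p: "p \<in> N" by auto
  interpret Metric_space N e using assms by (simp add: class_A_def)
  have fin: "finite N" using assms by (simp add: class_A_def)
  have v: "e x y = 1 \<or> e x y = 2 \<or> e x y = 3" if "x \<in> N" "y \<in> N" "x \<noteq> y" for x y
    using assms that by (auto simp: class_A_def)
  have T: "{#e x y, e y z, e x z#} \<in> {{#1, 1, 2#}, {#1, 2, 3#}, {#2, 2, 2#}}"
    if "x \<in> N" "y \<in> N" "z \<in> N" "x \<noteq> y" "y \<noteq> z" "x \<noteq> z" for x y z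
    using assms that by (auto simp: class_A_def)
  have tr: "(e x y = 1 \<and> e y z = 1 \<and> e x z = 2) \<or> (e x y = 1 \<and> e y z = 2 \<and> e x z = 1)
      \<or> (e x y = 2 \<and> e y z = 1 \<and> e x z = 1) \<or> (e x y = 2 \<and> e y z = 2 \<and> e x z = 2)
      \<or> (e x y = 1 \<and> e y z = 2 \<and> e x z = 3) \<or> (e x y = 1 \<and> e y z = 3 \<and> e x z = 2)
      \<or> (e x y = 2 \<and> e y z = 1 \<and> e x z = 3) \<or> (e x y = 2 \<and> e y z = 3 \<and> e x z = 1)
      \<or> (e x y = 3 \<and> e y z = 1 \<and> e x z = 2) \<or> (e x y = 3 \<and> e y z = 2 \<and> e x z = 1)"
    if "x \<in> N" "y \<in> N" "z \<in> N" "x \<noteq> y" "y \<noteq> z" "x \<noteq> z" for x y z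
  proof -
    have "sum_mset {#e x y, e y z, e x z#} \<in> sum_mset ` {{#1, 1, 2#}, {#1, 2, 3#}, {#2, 2, 2#}}"
      using T[OF that] by (rule imageI)
    then have "e x y + (e y z + e x z) = 4 \<or> e x y + (e y z + e x z) = 6" by simp
    then show ?thesis
      by (rule dist_sum_cases[OF v[OF that(1,2,4)] v[OF that(2,3,5)] v[OF that(1,3,6)]])
  qed
  define side where "side x \<longleftrightarrow> x = p \<or> e p x = 2" for x
  define S where "S x = {y \<in> N. y = x \<or> e x y = 3}" for x
  have S0: "finite (S x)" "x \<in> N \<Longrightarrow> x \<in> S x" for x using fin by (auto simp: S_def)
  have z: "e x x = 0" if "x \<in> N" for x using that by simp
  have side: "e x y = 2 \<longleftrightarrow> side x = side y" if "x \<in> N" "y \<in> N" "x \<noteq> y" for x y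
    using tr[OF p that(1,2)] that commute[of x p] z[OF p] unfolding side_def
    by (smt (verit))
  have S3: "S x = S y" if "x \<in> N" "y \<in> N" "e x y = 3" for x y
  proof -
    have ne: "x \<noteq> y" using that z by auto
    have "w \<in> S x \<longleftrightarrow> w \<in> S y" for w
      using tr[OF that(1,2), of w] that ne commute[of x y] z unfolding S_def mem_Collect_eq
      by (smt (verit))
    then show ?thesis by auto
  qed
  define ix where "ix x = Min (S x)" for x
  have ix3: "ix x = ix y" if "x \<in> N" "y \<in> N" "e x y = 3" for x y
    using S3[OF that] by (simp add: ix_def)
  have ixne: "x = y \<or> e x y = 3" if xy: "x \<in> N" "y \<in> N" and eq: "ix x = ix y" for x y
  proof -
    have a: "ix x \<in> S x" "ix x \<in> S y"
      unfolding eq using eq S0 xy by (metis Min_in empty_iff ix_def)+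
    show ?thesis
      using a tr[OF xy, of "ix x"] commute[of x y] unfolding S_def mem_Collect_eq
      by (smt (verit))
  qed
  define f where "f x = (ix x, side x)" for x
  have f: "gamma_dist (f x) (f y) = e x y" if xy: "x \<in> N" "y \<in> N" for x y
  proof (cases "x = y")
    case True
    then show ?thesis using z xy by (simp add: gamma_dist_def)
  next
    case False
    then show ?thesis using side[OF xy] ix3[OF xy] ixne[OF xy] v[OF xy]
      by (auto simp: gamma_dist_def f_def)
  qed
  have "inj_on f N"
  proof (rule inj_onI)
    fix x y assume "x \<in> N" "y \<in> N" "f x = f y"
    then show "x = y" using f[of x y] by (simp add: gamma_dist_def)
  qed
  then have "isometry N e (f ` N) gamma_dist f" using f by (auto simp: isometry_def bij_betw_def)
  then show ?thesis using fin unfolding isometric_def by blast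
qed

lemma fraisse_limit_gamma: "fraisse_limit class_A UNIV gamma_dist"
proof -
  have "\<exists>(N :: nat set) e. class_A N e \<and> isometric N e F gamma_dist" if fin: "finite F" for F
  proof -
    obtain f where f: "bij_betw f {..<card F} F" using ex_bij_betw_nat_finite[OF fin]
      by (auto simp: atLeast0LessThan)
    define e where "e = (\<lambda>x y. if x \<in> {..<card F} \<and> y \<in> {..<card F} then gamma_dist (f x) (f y) else 0)"
    have "class_A {..<card F} e" unfolding e_def by (rule class_A_transfer[OF class_A_gamma[OF fin] f])
    moreover have "isometric {..<card F} e F gamma_dist"
      unfolding isometric_def isometry_def using f by (intro exI[of _ f]) (auto simp: e_def)
    ultimately show ?thesis by blast
  qed
  then show ?thesis
    unfolding fraisse_limit_def
    using Metric_space_gamma homogeneous_gamma class_A_embeds_gamma by simp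
qed

end

theory Submission
  imports Defs
begin

text \<open>A member of the class is a two-coloured set with a partial matching between the colours. If at
  least \<open>k\<close> pairs are matched and each side has at least \<open>k\<close> unmatched points, the second player wins
  the \<open>k\<close>-round Ehrenfeucht--Fraisse game between any two such members, so the laws follow once almost
  all members are of this kind. An isomorphism class is given by the number of matched pairs and the
  unordered pair of side sizes, so there are quadratically many classes and only linearly many bad
  ones. Labeled members are double counted: one with fewer than \<open>k\<close> unmatched points on the
  first side has linearly many points on the second, and transferring any of these to the first
  side (dropping its edge) is at most \<open>O(k\<^sup>2)\<close>-to-one; one with fewer than \<open>k\<close> pairs has linearly
  many ways to match another pair, at most \<open>k\<close>-to-one. Finally, almost every member has an
  unmatched point, whereas by homogeneity the limit has none.\<close>

section \<open>Elementary equivalence of large finite subspaces of the limit\<close>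

lemma sat_isometry:
  assumes "isometry M d N d' f"
    and "\<And>x. x \<in> free_vars \<phi> \<Longrightarrow> e x \<in> M \<and> e' x = f (e x)"
  shows "sat M d e \<phi> \<longleftrightarrow> sat N d' e' \<phi>"
  using assms(2)
proof (induction \<phi> arbitrary: e e')
  case (Equal x y)
  then show ?case using assms(1) by (auto simp: isometry_def bij_betw_def inj_on_def)
next
  case (Rel r x y)
  then show ?case using assms(1) by (auto simp: isometry_def)
next
  case (Neg \<phi>)
  have "sat M d e \<phi> \<longleftrightarrow> sat N d' e' \<phi>" using Neg.prems by (intro Neg.IH) auto
  then show ?case by simp
next
  case (Conj \<phi> \<psi>)
  have "sat M d e \<phi> \<longleftrightarrow> sat N d' e' \<phi>" using Conj.prems by (intro Conj.IH) auto
  moreover have "sat M d e \<psi> \<longleftrightarrow> sat N d' e' \<psi>" using Conj.prems by (intro Conj.IH) auto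
  ultimately show ?case by simp
next
  case (Ex x \<phi>)
  have "sat M d (e(x := a)) \<phi> \<longleftrightarrow> sat N d' (e'(x := f a)) \<phi>" if "a \<in> M" for a
    using Ex.prems that by (intro Ex.IH) auto
  moreover have "f ` M = N" using assms(1) by (simp add: isometry_def bij_betw_def)
  ultimately show ?case by auto
qed

lemma models_isometric:
  assumes "sentence \<phi>" "isometric M d N d'"
  shows "models M d \<phi> \<longleftrightarrow> models N d' \<phi>"
proof -
  obtain f where "isometry M d N d' f" using assms(2) by (auto simp: isometric_def)
  then have "sat M d e \<phi> \<longleftrightarrow> sat N d' e' \<phi>" for e e'
    using assms(1) by (intro sat_isometry) (auto simp: sentence_def)
  then show ?thesis using models_sentence[OF assms(1)] by metis
qed

definition gamma_sub :: "nat set \<Rightarrow> nat set \<Rightarrow> (nat \<times> bool) set" where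
  "gamma_sub A B = A \<times> {False} \<union> B \<times> {True}"

definition partial_iso ::
    "nat set \<Rightarrow> nat set \<Rightarrow> nat set \<Rightarrow> nat set \<Rightarrow> (nat \<times> nat) set \<Rightarrow> bool" where
  "partial_iso A B A' B' R \<longleftrightarrow> finite R \<and>
     (\<forall>p\<in>R. \<forall>q\<in>R. fst p = fst q \<longleftrightarrow> snd p = snd q) \<and>
     (\<forall>p\<in>R. (fst p \<in> A \<longleftrightarrow> snd p \<in> A') \<and> (fst p \<in> B \<longleftrightarrow> snd p \<in> B'))"

definition ample :: "nat \<Rightarrow> nat set \<Rightarrow> nat set \<Rightarrow> bool" where
  "ample k A B \<longleftrightarrow> k \<le> card (A \<inter> B) \<and> k \<le> card (A - B) \<and> k \<le> card (B - A)"

lemma ample_mono: "ample k A B \<Longrightarrow> l \<le> k \<Longrightarrow> ample l A B"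
  by (auto simp: ample_def)

lemma partial_iso_converse: "partial_iso A B A' B' R \<Longrightarrow> partial_iso A' B' A B (R\<inverse>)"
  unfolding partial_iso_def by (auto; metis fst_conv snd_conv)

lemma partial_iso_extend:
  assumes R: "partial_iso A B A' B' R" and i: "i \<in> A \<union> B" and am: "ample (Suc (card R)) A' B'"
  obtains j R' where "partial_iso A B A' B' R'" "R \<subseteq> R'" "(i, j) \<in> R'" "card R' \<le> Suc (card R)"
proof (cases "i \<in> fst ` R")
  case True
  then show ?thesis using that[of R] R by force
next
  case False
  define T where "T = (if i \<in> A then if i \<in> B then A' \<inter> B' else A' - B' else B' - A')"
  have fin: "finite R" using R by (simp add: partial_iso_def)
  have "Suc (card R) \<le> card T" using am i by (auto simp: ample_def T_def)
  then have "card (snd ` R) < card T" using card_image_le[OF fin, of snd] by simp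
  then obtain j where j: "j \<in> T" "j \<notin> snd ` R"
    by (metis card_mono finite_imageI fin leD subsetI)
  have types: "(i \<in> A \<longleftrightarrow> j \<in> A') \<and> (i \<in> B \<longleftrightarrow> j \<in> B')"
    using i j(1) by (auto simp: T_def split: if_splits)
  have "partial_iso A B A' B' (insert (i, j) R)"
    using R j(2) False types unfolding partial_iso_def by (auto 4 3 simp: image_iff)
  then show ?thesis using that[of "insert (i, j) R" j] fin by (simp add: card_insert_if subset_insertI)
qed

text \<open>The state of an Ehrenfeucht--Fraisse game on indices: \<open>ample\<close> leaves enough fresh indices of
  each kind for the remaining quantifiers, of which there are at most \<open>size \<phi>\<close>.\<close>

lemma sat_gamma_sub:
  assumes "partial_iso A B A' B' R"
    and "ample (card R + size \<phi>) A B" "ample (card R + size \<phi>) A' B'"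
    and "\<And>x. x \<in> free_vars \<phi> \<Longrightarrow> (fst (e x), fst (e' x)) \<in> R \<and> snd (e x) = snd (e' x)"
  shows "sat (gamma_sub A B) gamma_dist e \<phi> \<longleftrightarrow> sat (gamma_sub A' B') gamma_dist e' \<phi>"
  using assms
proof (induction \<phi> arbitrary: A B A' B' R e e')
  case (Equal x y)
  have "fst (e x) = fst (e y) \<longleftrightarrow> fst (e' x) = fst (e' y)"
    using Equal.prems(1) Equal.prems(4)[of x] Equal.prems(4)[of y] by (force simp: partial_iso_def)
  then show ?case using Equal.prems(4)[of x] Equal.prems(4)[of y] by (simp add: prod_eq_iff)
next
  case (Rel r x y)
  have "fst (e x) = fst (e y) \<longleftrightarrow> fst (e' x) = fst (e' y)"
    using Rel.prems(1) Rel.prems(4)[of x] Rel.prems(4)[of y] by (force simp: partial_iso_def)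
  then show ?case using Rel.prems(4)[of x] Rel.prems(4)[of y] by (simp add: gamma_dist_def)
next
  case (Neg \<phi>)
  have "sat (gamma_sub A B) gamma_dist e \<phi> \<longleftrightarrow> sat (gamma_sub A' B') gamma_dist e' \<phi>"
    using Neg.prems by (intro Neg.IH[of _ _ _ _ R]) (auto elim: ample_mono)
  then show ?case by simp
next
  case (Conj \<phi> \<psi>)
  have "sat (gamma_sub A B) gamma_dist e \<phi> \<longleftrightarrow> sat (gamma_sub A' B') gamma_dist e' \<phi>"
    using Conj.prems by (intro Conj.IH(1)[of _ _ _ _ R]) (auto elim: ample_mono)
  moreover have "sat (gamma_sub A B) gamma_dist e \<psi> \<longleftrightarrow> sat (gamma_sub A' B') gamma_dist e' \<psi>"
    using Conj.prems by (intro Conj.IH(2)[of _ _ _ _ R]) (auto elim: ample_mono)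
  ultimately show ?case by simp
next
  case (Ex x \<phi>)
  have step: "\<exists>b\<in>gamma_sub A' B'. sat (gamma_sub A' B') gamma_dist (e'(x := b)) \<phi>"
    if R: "partial_iso A B A' B' R"
      and am: "ample (card R + size (Ex x \<phi>)) A B" "ample (card R + size (Ex x \<phi>)) A' B'"
      and ee: "\<And>y. y \<in> free_vars \<phi> - {x} \<Longrightarrow> (fst (e y), fst (e' y)) \<in> R \<and> snd (e y) = snd (e' y)"
      and a: "a \<in> gamma_sub A B" "sat (gamma_sub A B) gamma_dist (e(x := a)) \<phi>"
    for A B A' B' R a and e e' :: "nat \<Rightarrow> nat \<times> bool"
  proof -
    have "fst a \<in> A \<union> B" using a(1) by (auto simp: gamma_sub_def)
    moreover have "ample (Suc (card R)) A' B'" using am(2) by (rule ample_mono) simp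
    ultimately obtain j R' where R': "partial_iso A B A' B' R'" "R \<subseteq> R'" "(fst a, j) \<in> R'"
        "card R' \<le> Suc (card R)"
      using partial_iso_extend[OF R] by metis
    let ?b = "(j, snd a)"
    have "?b \<in> gamma_sub A' B'"
      using a(1) R'(1,3) by (force simp: gamma_sub_def partial_iso_def)
    moreover have "sat (gamma_sub A' B') gamma_dist (e'(x := ?b)) \<phi>"
    proof (subst Ex.IH[symmetric, of A B A' B' R' "e(x := a)"])
      show "ample (card R' + size \<phi>) A B" using am(1) by (rule ample_mono) (use R'(4) in simp)
      show "ample (card R' + size \<phi>) A' B'" using am(2) by (rule ample_mono) (use R'(4) in simp)
    qed (use R' ee a(2) in auto)
    ultimately show ?thesis by blast
  qed
  show ?case
    using step[OF Ex.prems(1), of e e'] step[OF partial_iso_converse[OF Ex.prems(1)], of e' e] Ex.prems(2-4)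
    by (auto simp: card_inverse)
qed

lemma models_gamma_sub:
  assumes "sentence \<phi>" "ample (size \<phi>) A B" "ample (size \<phi>) A' B'"
  shows "models (gamma_sub A B) gamma_dist \<phi> \<longleftrightarrow> models (gamma_sub A' B') gamma_dist \<phi>"
proof -
  have "sat (gamma_sub A B) gamma_dist e \<phi> \<longleftrightarrow> sat (gamma_sub A' B') gamma_dist e' \<phi>" for e e'
    using assms by (intro sat_gamma_sub[where R = "{}"]) (auto simp: sentence_def partial_iso_def)
  then show ?thesis using models_sentence[OF assms(1)] by metis
qed

section \<open>Configurations: two sides and a partial matching\<close>

definition configs :: "nat \<Rightarrow> (nat set \<times> (nat \<times> nat) set) set" where
  "configs n = {(P, M). P \<subseteq> {1..n} \<and> M \<subseteq> P \<times> ({1..n} - P) \<and> inj_on fst M \<and> inj_on snd M}"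

definition cdist :: "nat \<Rightarrow> nat set \<times> (nat \<times> nat) set \<Rightarrow> nat \<Rightarrow> nat \<Rightarrow> real" where
  "cdist n t x y =
     (if x \<notin> {1..n} \<or> y \<notin> {1..n} \<or> x = y then 0
      else if x \<in> fst t \<longleftrightarrow> y \<in> fst t then 2
      else if (x, y) \<in> snd t \<or> (y, x) \<in> snd t then 3 else 1)"

definition slot :: "(nat \<times> nat) set \<Rightarrow> nat \<Rightarrow> nat" where
  "slot M y = (if y \<in> snd ` M then fst (inv_into M snd y) else y)"

lemma slot_matched: "inj_on snd M \<Longrightarrow> (x, y) \<in> M \<Longrightarrow> slot M y = x"
  using inv_into_f_f[of snd M "(x, y)"] by (force simp: slot_def)

lemma slot_unmatched: "y \<notin> snd ` M \<Longrightarrow> slot M y = y"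
  by (simp add: slot_def)

lemma finite_configs: "finite (configs n)"
  by (rule finite_subset[of _ "Pow {1..n} \<times> Pow ({1..n} \<times> {1..n})"]) (auto simp: configs_def)

lemma configs_empty: "({}, {}) \<in> configs n"
  by (simp add: configs_def)

lemma configs_finite: "(P, M) \<in> configs n \<Longrightarrow> finite P \<and> finite M"
  using finite_subset[of P "{1..n}"] finite_subset[of M "P \<times> ({1..n} - P)"] by (auto simp: configs_def)

lemma configs_card:
  assumes "(P, M) \<in> configs n"
  shows "card P = card M + card (P - fst ` M)"
    and "card ({1..n} - P) = card M + card ({1..n} - P - snd ` M)"
    and "card P + card ({1..n} - P) = n"
proof -
  have fin: "finite P" "finite M" using configs_finite[OF assms] by auto
  have c: "card (fst ` M) = card M" "card (snd ` M) = card M"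
    using assms by (auto simp: configs_def card_image)
  have sub: "fst ` M \<subseteq> P" "snd ` M \<subseteq> {1..n} - P" "P \<subseteq> {1..n}" using assms by (auto simp: configs_def)
  show "card P = card M + card (P - fst ` M)"
    using card_Diff_subset[of "fst ` M" P] card_mono[OF fin(1) sub(1)] fin sub c by simp
  show "card ({1..n} - P) = card M + card ({1..n} - P - snd ` M)"
    using card_Diff_subset[of "snd ` M" "{1..n} - P"] card_mono[OF _ sub(2)] fin sub c by simp
  show "card P + card ({1..n} - P) = n"
    using card_Diff_subset[of P "{1..n}"] card_mono[OF _ sub(3)] fin sub by simp
qed

definition pos :: "nat set \<times> (nat \<times> nat) set \<Rightarrow> nat \<Rightarrow> nat \<times> bool" where
  "pos t x = (if x \<in> fst t then x else slot (snd t) x, x \<notin> fst t)"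

lemma slot_cases:
  assumes "(P, M) \<in> configs n" "y \<in> {1..n} - P"
  obtains "(slot M y, y) \<in> M" "slot M y \<in> P" | "y \<notin> snd ` M" "slot M y = y"
proof (cases "y \<in> snd ` M")
  case True
  then obtain x where "(x, y) \<in> M" by auto
  then show ?thesis using that(1) slot_matched[of M x y] assms(1) by (auto simp: configs_def)
qed (use that(2) slot_unmatched in auto)

lemma slot_eq_iff:
  assumes t: "(P, M) \<in> configs n" and y: "y \<in> {1..n} - P"
  shows "x \<in> P \<Longrightarrow> slot M y = x \<longleftrightarrow> (x, y) \<in> M"
    and "z \<in> {1..n} - P \<Longrightarrow> slot M y = slot M z \<longleftrightarrow> y = z"
proof -
  have inj: "inj_on snd M" "inj_on fst M" using t by (auto simp: configs_def)
  show "slot M y = x \<longleftrightarrow> (x, y) \<in> M" if "x \<in> P"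
  proof (cases rule: slot_cases[OF t y])
    case 1
    then show ?thesis using slot_matched[OF inj(1), of x y] by metis
  next
    case 2
    then show ?thesis using that y by force
  qed
  show "slot M y = slot M z \<longleftrightarrow> y = z" if z: "z \<in> {1..n} - P"
  proof
    assume eq: "slot M y = slot M z"
    show "y = z"
    proof (cases rule: slot_cases[OF t y])
      case 1
      note y1 = 1
      show ?thesis
      proof (cases rule: slot_cases[OF t z])
        case 1
        then have "(slot M y, y) = (slot M y, z)" using inj_onD[OF inj(2), of "(slot M y, y)" "(slot M y, z)"] y1 eq by simp
        then show ?thesis by simp
      qed (use y1 z eq in auto)
    next
      case 2
      then show ?thesis using eq y by (cases rule: slot_cases[OF t z]) auto
    qed
  qed auto
qed

lemma cdist_eq_gamma:
  assumes "t \<in> configs n" "x \<in> {1..n}" "y \<in> {1..n}"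
  shows "cdist n t x y = gamma_dist (pos t x) (pos t y)"
proof -
  obtain P M where t: "t = (P, M)" "(P, M) \<in> configs n" using assms(1) by (cases t) auto
  have "M \<subseteq> P \<times> ({1..n} - P)" using t(2) by (simp add: configs_def)
  then show ?thesis
    using assms(2,3) slot_eq_iff(1)[OF t(2), of x y] slot_eq_iff(1)[OF t(2), of y x]
      slot_eq_iff(2)[OF t(2), of x y] unfolding t cdist_def gamma_dist_def pos_def
    by (cases "x \<in> P"; cases "y \<in> P") (auto simp del: atLeastAtMost_iff)
qed

lemma pos_bij:
  assumes "(P, M) \<in> configs n"
  shows "bij_betw (pos (P, M)) {1..n} (gamma_sub P (slot M ` ({1..n} - P)))"
proof -
  have sub: "P \<subseteq> {1..n}" using assms by (simp add: configs_def)
  have "inj_on (pos (P, M)) {1..n}"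
    using slot_eq_iff(2)[OF assms] by (auto simp: inj_on_def pos_def split: if_splits)
  moreover have "pos (P, M) ` {1..n} = gamma_sub P (slot M ` ({1..n} - P))"
  proof -
    have "pos (P, M) ` P = P \<times> {False}" by (force simp: pos_def)
    moreover have "pos (P, M) ` ({1..n} - P) = slot M ` ({1..n} - P) \<times> {True}"
      by (force simp: pos_def)
    moreover have "{1..n} = P \<union> ({1..n} - P)" using sub by blast
    ultimately show ?thesis unfolding gamma_sub_def by (metis image_Un)
  qed
  ultimately show ?thesis by (simp add: bij_betw_def)
qed

lemma isometric_gamma_sub:
  assumes "(P, M) \<in> configs n"
  shows "isometric {1..n} (cdist n (P, M)) (gamma_sub P (slot M ` ({1..n} - P))) gamma_dist"
  unfolding isometric_def isometry_def using pos_bij[OF assms] cdist_eq_gamma[OF assms] by auto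

lemma slots:
  assumes t: "(P, M) \<in> configs n" and B: "B = slot M ` ({1..n} - P)"
  shows "P \<inter> B = fst ` M" "P - B = P - fst ` M" "B - P = {1..n} - P - snd ` M"
proof -
  have sub: "M \<subseteq> P \<times> ({1..n} - P)" "inj_on snd M" using t by (auto simp: configs_def)
  have "B = fst ` M \<union> ({1..n} - P - snd ` M)"
  proof (intro equalityI subsetI)
    fix i assume "i \<in> B"
    then obtain y where y: "y \<in> {1..n} - P" "i = slot M y" using B by blast
    show "i \<in> fst ` M \<union> ({1..n} - P - snd ` M)"
      by (cases rule: slot_cases[OF t y(1)]) (use y in force)+
  next
    fix i assume "i \<in> fst ` M \<union> ({1..n} - P - snd ` M)"
    then show "i \<in> B"
    proof
      assume "i \<in> fst ` M"
      then obtain y where "(i, y) \<in> M" by auto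
      then show ?thesis using slot_matched[OF sub(2)] sub(1) B by blast
    next
      assume "i \<in> {1..n} - P - snd ` M"
      then show ?thesis using slot_unmatched B by (metis DiffD1 DiffD2 image_eqI)
    qed
  qed
  then show "P \<inter> B = fst ` M" "P - B = P - fst ` M" "B - P = {1..n} - P - snd ` M"
    using sub(1) by auto
qed

lemma class_A_cdist: "t \<in> configs n \<Longrightarrow> class_A {1..n} (cdist n t)"
proof -
  assume t: "t \<in> configs n"
  obtain P M where PM: "t = (P, M)" by (cases t)
  let ?F = "gamma_sub P (slot M ` ({1..n} - P))"
  have bij: "bij_betw (pos t) {1..n} ?F" using pos_bij t PM by simp
  then have "finite ?F" by (metis bij_betw_finite finite_atLeastAtMost)
  from class_A_transfer[OF class_A_gamma[OF this] bij]
  have "class_A {1..n} (\<lambda>x y. if x \<in> {1..n} \<and> y \<in> {1..n} then gamma_dist (pos t x) (pos t y) else 0)" .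
  moreover have "(\<lambda>x y. if x \<in> {1..n} \<and> y \<in> {1..n} then gamma_dist (pos t x) (pos t y) else 0) = cdist n t"
  proof (intro ext)
    fix x y
    show "(if x \<in> {1..n} \<and> y \<in> {1..n} then gamma_dist (pos t x) (pos t y) else 0) = cdist n t x y"
    proof (cases "x \<in> {1..n} \<and> y \<in> {1..n}")
      case True
      then show ?thesis using cdist_eq_gamma[OF t, of x y] by simp
    next
      case False
      then show ?thesis unfolding cdist_def by argo
    qed
  qed
  ultimately show ?thesis by simp
qed

lemma labeled_eq: "labeled class_A n = cdist n ` configs n"
proof (intro equalityI subsetI)
  fix d assume "d \<in> cdist n ` configs n"
  then show "d \<in> labeled class_A n" using class_A_cdist by (auto simp: labeled_def cdist_def)
next
  fix d assume "d \<in> labeled class_A n"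
  then have d: "class_A {1..n} d" "\<And>x y. x \<notin> {1..n} \<or> y \<notin> {1..n} \<Longrightarrow> d x y = 0"
    unfolding labeled_def by blast+
  obtain f F where "isometry {1..n} d F gamma_dist f"
    using class_A_embeds_gamma[OF d(1)] by (auto simp: isometric_def)
  then have f: "inj_on f {1..n}" "\<And>x y. x \<in> {1..n} \<Longrightarrow> y \<in> {1..n} \<Longrightarrow> d x y = gamma_dist (f x) (f y)"
    by (auto simp: isometry_def bij_betw_def)
  define P where "P = {x \<in> {1..n}. snd (f x)}"
  define M where "M = {(x, y). x \<in> P \<and> y \<in> {1..n} - P \<and> fst (f x) = fst (f y)}"
  have "inj_on fst M"
  proof (rule inj_onI)
    fix p q assume pq: "p \<in> M" "q \<in> M" "fst p = fst q"
    then have "f (snd p) = f (snd q)" by (auto simp: M_def P_def prod_eq_iff)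
    moreover have "snd p \<in> {1..n}" "snd q \<in> {1..n}" using pq by (auto simp: M_def)
    ultimately show "p = q" using pq(3) inj_onD[OF f(1)] by (metis prod_eq_iff)
  qed
  moreover have "inj_on snd M"
  proof (rule inj_onI)
    fix p q assume pq: "p \<in> M" "q \<in> M" "snd p = snd q"
    then have "f (fst p) = f (fst q)" by (auto simp: M_def P_def prod_eq_iff)
    moreover have "fst p \<in> {1..n}" "fst q \<in> {1..n}" using pq by (auto simp: M_def P_def)
    ultimately show "p = q" using pq(3) inj_onD[OF f(1)] by (metis prod_eq_iff)
  qed
  ultimately have "(P, M) \<in> configs n" by (auto simp: configs_def P_def M_def)
  moreover have "d = cdist n (P, M)"
  proof (intro ext)
    fix x y
    show "d x y = cdist n (P, M) x y"
    proof (cases "x \<in> {1..n} \<and> y \<in> {1..n}")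
      case True
      then have "fst (f x) = fst (f y) \<and> snd (f x) = snd (f y) \<longleftrightarrow> x = y"
        using inj_on_eq_iff[OF f(1), of x y] by (simp add: prod_eq_iff)
      then show ?thesis using True f(2)[of x y]
        by (auto simp: cdist_def P_def M_def gamma_dist_def)
    next
      case False
      then show ?thesis using d(2)[of x y] unfolding cdist_def by auto
    qed
  qed
  ultimately show "d \<in> cdist n ` configs n" by blast
qed

lemma cdist_swap:
  assumes "(P, M) \<in> configs n"
  shows "({1..n} - P, M\<inverse>) \<in> configs n" "cdist n ({1..n} - P, M\<inverse>) = cdist n (P, M)"
proof -
  show "({1..n} - P, M\<inverse>) \<in> configs n"
    using assms unfolding configs_def by (auto simp: inj_on_def; metis fst_conv snd_conv)
  show "cdist n ({1..n} - P, M\<inverse>) = cdist n (P, M)"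
    by (intro ext) (auto simp: cdist_def)
qed

lemma matching_eq:
  assumes "(P, M) \<in> configs n"
  shows "M = {(x, y). x \<in> P \<and> y \<in> {1..n} - P \<and> cdist n (P, M) x y = 3}"
  using assms by (auto simp: configs_def cdist_def)

lemma cdist_eqD:
  assumes t: "(P, M) \<in> configs n" and t': "(P', M') \<in> configs n"
    and eq: "cdist n (P, M) = cdist n (P', M')"
  shows "P' = P \<and> M' = M \<or> P' = {1..n} - P \<and> M' = M\<inverse>"
proof -
  have sub: "P \<subseteq> {1..n}" "P' \<subseteq> {1..n}" using t t' by (auto simp: configs_def)
  have same: "(x \<in> P \<longleftrightarrow> y \<in> P) \<longleftrightarrow> (x \<in> P' \<longleftrightarrow> y \<in> P')" if "x \<in> {1..n}" "y \<in> {1..n}" for x y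
    using fun_cong[OF fun_cong[OF eq], of x y] that unfolding cdist_def by (auto split: if_splits)
  have 1: "M' = N'" if "(P', N') \<in> configs n" "cdist n (P', N') = cdist n (P', M')" for N'
  proof -
    have "M' = {(x, y). x \<in> P' \<and> y \<in> {1..n} - P' \<and> cdist n (P', M') x y = 3}"
      by (rule matching_eq[OF t'])
    also have "\<dots> = N'" by (simp only: that(2)[symmetric] matching_eq[OF that(1), symmetric])
    finally show ?thesis .
  qed
  show ?thesis
  proof (cases "P' = P")
    case True
    then show ?thesis using 1 t eq by metis
  next
    case False
    then obtain x0 where x0: "x0 \<in> {1..n}" "x0 \<in> P \<longleftrightarrow> x0 \<notin> P'" using sub by blast
    have P': "P' = {1..n} - P" using same[OF x0(1)] x0(2) sub by blast
    moreover have "M' = M\<inverse>" using 1 cdist_swap[OF t] eq P' by metis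
    ultimately show ?thesis by blast
  qed
qed

lemma isometric_refl: "isometric M d M d"
  unfolding isometric_def isometry_def by (intro exI[of _ id]) auto

lemma isometric_sym: "isometric M d N e \<Longrightarrow> isometric N e M d"
proof -
  assume "isometric M d N e"
  then obtain f where f: "bij_betw f M N" "\<And>x y. x \<in> M \<Longrightarrow> y \<in> M \<Longrightarrow> e (f x) (f y) = d x y"
    by (auto simp: isometric_def isometry_def)
  have "d (inv_into M f u) (inv_into M f v) = e u v" if "u \<in> N" "v \<in> N" for u v
  proof -
    have "inv_into M f u \<in> M" "inv_into M f v \<in> M"
      using that bij_betw_inv_into[OF f(1)] by (auto simp: bij_betw_def)
    then show ?thesis using f(2) bij_betw_inv_into_right[OF f(1)] that by metis
  qed
  then show ?thesis
    unfolding isometric_def isometry_def using bij_betw_inv_into[OF f(1)] by blast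
qed

lemma isometric_trans: "isometric M d N e \<Longrightarrow> isometric N e K h \<Longrightarrow> isometric M d K h"
proof -
  assume "isometric M d N e" "isometric N e K h"
  then obtain f g where f: "bij_betw f M N" "\<And>x y. x \<in> M \<Longrightarrow> y \<in> M \<Longrightarrow> e (f x) (f y) = d x y"
    and g: "bij_betw g N K" "\<And>x y. x \<in> N \<Longrightarrow> y \<in> N \<Longrightarrow> h (g x) (g y) = e x y"
    unfolding isometric_def isometry_def by blast
  have "h ((g \<circ> f) x) ((g \<circ> f) y) = d x y" if "x \<in> M" "y \<in> M" for x y
    using f(2)[OF that] g(2)[of "f x" "f y"] f(1) that by (auto simp: bij_betw_def)
  then show ?thesis
    unfolding isometric_def isometry_def using bij_betw_trans[OF f(1) g(1)] by blast
qed

lemma isometric_gamma_subI: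
  assumes fin: "finite A" "finite B" "finite A'" "finite B'"
    and card: "card (A \<inter> B) = card (A' \<inter> B')" "card (A - B) = card (A' - B')" "card (B - A) = card (B' - A')"
  shows "isometric (gamma_sub A B) gamma_dist (gamma_sub A' B') gamma_dist"
proof -
  obtain f1 f2 f3 where f: "bij_betw f1 (A \<inter> B) (A' \<inter> B')" "bij_betw f2 (A - B) (A' - B')"
      "bij_betw f3 (B - A) (B' - A')"
    using card fin by (metis finite_same_card_bij finite_Int finite_Diff)
  define h where "h i = (if i \<in> A then if i \<in> B then f1 i else f2 i else f3 i)" for i
  have h1: "bij_betw h (A \<inter> B) (A' \<inter> B')"
    using f(1) by (subst bij_betw_cong[of _ _ f1]) (auto simp: h_def)
  have h2: "bij_betw h (A - B) (A' - B')"
    using f(2) by (subst bij_betw_cong[of _ _ f2]) (auto simp: h_def)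
  have h3: "bij_betw h (B - A) (B' - A')"
    using f(3) by (subst bij_betw_cong[of _ _ f3]) (auto simp: h_def)
  have hA: "bij_betw h A A'"
    using bij_betw_combine[OF h1 h2] by (simp add: Int_Diff_Un Int_Diff_disjoint)
  have hB: "bij_betw h B B'"
    using bij_betw_combine[OF h1 h3] by (simp add: Int_commute[of A] Int_commute[of A'] Int_Diff_Un Int_Diff_disjoint)
  have hAB: "bij_betw h (A \<union> B) (A' \<union> B')"
    using bij_betw_combine[OF hA h3] by (simp add: Diff_disjoint)
  have inj: "h i = h j \<longleftrightarrow> i = j" if "i \<in> A \<union> B" "j \<in> A \<union> B" for i j
    using hAB that by (auto simp: bij_betw_def inj_on_def)
  let ?h = "map_prod h id"
  have mem: "fst p \<in> A \<union> B" if "p \<in> gamma_sub A B" for p using that by (auto simp: gamma_sub_def)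
  have "inj_on ?h (gamma_sub A B)"
    using inj mem by (auto simp: inj_on_def)
  moreover have "?h ` gamma_sub A B = gamma_sub (h ` A) (h ` B)"
    unfolding gamma_sub_def image_Un map_prod_image by simp
  ultimately have "bij_betw ?h (gamma_sub A B) (gamma_sub A' B')"
    using hA hB by (simp add: bij_betw_def)
  moreover have "gamma_dist (?h p) (?h q) = gamma_dist p q"
    if "p \<in> gamma_sub A B" "q \<in> gamma_sub A B" for p q
    using inj mem that by (simp add: gamma_dist_def)
  ultimately show ?thesis unfolding isometric_def isometry_def by blast
qed

lemma isometric_cdistI:
  assumes t: "(P, M) \<in> configs n" "(P', M') \<in> configs n" and c: "card M = card M'" "card P = card P'"
  shows "isometric {1..n} (cdist n (P, M)) {1..n} (cdist n (P', M'))"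
proof -
  let ?B = "slot M ` ({1..n} - P)" and ?B' = "slot M' ` ({1..n} - P')"
  note s = slots[OF t(1) refl] slots[OF t(2) refl]
  have c': "card (fst ` M) = card (fst ` M')"
    using t c(1) by (auto simp: configs_def card_image)
  have "isometric (gamma_sub P ?B) gamma_dist (gamma_sub P' ?B') gamma_dist"
  proof (rule isometric_gamma_subI)
    show "card (P \<inter> ?B) = card (P' \<inter> ?B')" unfolding s using c' .
    show "card (P - ?B) = card (P' - ?B')" "card (?B - P) = card (?B' - P')"
      unfolding s using configs_card[OF t(1)] configs_card[OF t(2)] c by linarith+
  qed (use configs_finite t in auto)
  from isometric_trans[OF isometric_trans[OF isometric_gamma_sub[OF t(1)] this]
      isometric_sym[OF isometric_gamma_sub[OF t(2)]]]
  show ?thesis .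
qed

lemma isometric_cdistD:
  assumes t: "(P, M) \<in> configs n" "(P', M') \<in> configs n"
    and iso: "isometric {1..n} (cdist n (P, M)) {1..n} (cdist n (P', M'))"
  shows "card M' = card M" "card P' = card P \<or> card P' = n - card P"
proof -
  obtain f where f: "bij_betw f {1..n} {1..n}"
    and d: "\<And>x y. x \<in> {1..n} \<Longrightarrow> y \<in> {1..n} \<Longrightarrow> cdist n (P', M') (f x) (f y) = cdist n (P, M) x y"
    using iso unfolding isometric_def isometry_def by blast
  have sub: "P \<subseteq> {1..n}" "M \<subseteq> P \<times> ({1..n} - P)" and inj: "inj_on fst M" "inj_on snd M"
    using t(1) by (auto simp: configs_def)
  have sub': "M \<subseteq> {1..n} \<times> {1..n}" using sub by auto
  have finj: "inj_on f {1..n}" and im: "f ` {1..n} = {1..n}" using f by (auto simp: bij_betw_def)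
  have fP: "f x \<in> f ` P \<longleftrightarrow> x \<in> P" if "x \<in> {1..n}" for x
    using inj_on_image_mem_iff[OF finj that sub(1)] .
  have minj: "inj_on (map_prod f f) ({1..n} \<times> {1..n})" using map_prod_inj_on[OF finj finj] .
  let ?M = "map_prod f f ` M"
  have fM: "(f x, f y) \<in> ?M \<longleftrightarrow> (x, y) \<in> M" if "x \<in> {1..n}" "y \<in> {1..n}" for x y
    using inj_on_image_mem_iff[OF minj _ sub', of "(x, y)"] that by simp
  have "?M \<subseteq> f ` P \<times> ({1..n} - f ` P)"
  proof
    fix p assume "p \<in> ?M"
    then obtain x y where "p = (f x, f y)" "(x, y) \<in> M" by auto
    then show "p \<in> f ` P \<times> ({1..n} - f ` P)" using sub sub' fP[of y] im by blast
  qed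
  moreover have "inj_on fst ?M"
  proof (rule inj_on_imageI)
    have "inj_on (f \<circ> fst) M"
      by (rule comp_inj_on[OF inj(1) inj_on_subset[OF finj]]) (use sub' in auto)
    then show "inj_on (fst \<circ> map_prod f f) M" by (simp only: fst_comp_map_prod)
  qed
  moreover have "inj_on snd ?M"
  proof (rule inj_on_imageI)
    have "inj_on (f \<circ> snd) M"
      by (rule comp_inj_on[OF inj(2) inj_on_subset[OF finj]]) (use sub' in auto)
    then show "inj_on (snd \<circ> map_prod f f) M" by (simp only: snd_comp_map_prod)
  qed
  moreover have "f ` P \<subseteq> {1..n}" using sub(1) im by blast
  ultimately have t'': "(f ` P, ?M) \<in> configs n" by (simp add: configs_def)
  have "cdist n (f ` P, ?M) = cdist n (P', M')"
  proof (intro ext)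
    fix u v
    show "cdist n (f ` P, ?M) u v = cdist n (P', M') u v"
    proof (cases "u \<in> {1..n} \<and> v \<in> {1..n}")
      case True
      then obtain x y where xy: "u = f x" "v = f y" "x \<in> {1..n}" "y \<in> {1..n}" using im by blast
      then have "cdist n (f ` P, ?M) (f x) (f y) = cdist n (P, M) x y"
        using True fP fM inj_on_eq_iff[OF finj] unfolding cdist_def by simp
      then show ?thesis using d xy by simp
    qed (auto simp: cdist_def)
  qed
  from cdist_eqD[OF t'' t(2) this]
  have "card M' = card ?M" "card P' = card (f ` P) \<or> card P' = n - card (f ` P)"
    using card_inverse[of ?M] card_Diff_subset[of "f ` P" "{1..n}"] configs_finite[OF t'']
      t'' by (auto simp: configs_def)
  moreover have "card ?M = card M" "card (f ` P) = card P"
    using inj_on_subset[OF minj sub'] inj_on_subset[OF finj sub(1)] by (simp_all add: card_image)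
  ultimately show "card M' = card M" "card P' = card P \<or> card P' = n - card P" by auto
qed

lemma card_few_unmatched:
  fixes k n :: nat
  defines "S \<equiv> {t \<in> configs n. card (fst t - fst ` snd t) < k}"
  shows "(n - k) * card S \<le> 2 * (k + 1)\<^sup>2 * card (configs n)"
proof -
  define E where "E t = fst t - fst ` snd t" for t :: "nat set \<times> (nat \<times> nat) set"
  define X where "X = (SIGMA t:S. {1..n} - fst t)"
  define Y where "Y = (SIGMA t:{t \<in> configs n. card (E t) \<le> k + 1}. E t \<times> E t)"
  define F where "F = (\<lambda>(t :: nat set \<times> (nat \<times> nat) set, y :: nat).
    ((insert y (fst t), {p \<in> snd t. snd p \<noteq> y}), (y, slot (snd t) y)))"
  have finS: "finite S" unfolding S_def using finite_configs[of n] by simp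
  have finE: "finite (E t)" if "t \<in> configs n" for t
    using configs_finite[of "fst t" "snd t" n] that by (simp add: E_def)
  have finY: "finite Y" unfolding Y_def using finite_configs[of n] finE by auto
  have "inj_on F X"
  proof (rule inj_onI)
    fix u v assume uv: "u \<in> X" "v \<in> X" "F u = F v"
    have inv: "fst t = insert y (fst t) - {y}"
        "snd t = {p \<in> snd t. snd p \<noteq> y} \<union> (if slot (snd t) y = y then {} else {(slot (snd t) y, y)})"
      if "(t, y) \<in> X" for t y
    proof -
      have t: "(fst t, snd t) \<in> configs n" "y \<in> {1..n} - fst t" using that by (auto simp: X_def S_def)
      then have "inj_on snd (snd t)" unfolding configs_def by blast
      then have matched: "p = (slot (snd t) y, y)" if "p \<in> snd t" "snd p = y" for p
        using slot_matched[of "snd t"] that by (cases p) auto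
      show "fst t = insert y (fst t) - {y}" using t(2) by blast
      show "snd t = {p \<in> snd t. snd p \<noteq> y} \<union> (if slot (snd t) y = y then {} else {(slot (snd t) y, y)})"
      proof (cases rule: slot_cases[OF t])
        case 1
        then have "slot (snd t) y \<noteq> y" using t(2) by auto
        then show ?thesis using matched 1(1) by (simp only: if_False) blast
      next
        case 2
        then show ?thesis by auto
      qed
    qed
    obtain t y t' y' where e: "u = (t, y)" "v = (t', y')" by (metis surj_pair)
    from uv(3) have eq: "y' = y" "insert y (fst t) = insert y (fst t')"
        "{p \<in> snd t. snd p \<noteq> y} = {p \<in> snd t'. snd p \<noteq> y}" "slot (snd t) y = slot (snd t') y"
      unfolding F_def e by auto
    have "fst t = fst t'" using inv(1)[of t y] inv(1)[of t' y] uv(1,2) eq e by metis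
    moreover have "snd t = snd t'" using inv(2)[of t y] inv(2)[of t' y] uv(1,2) eq e by metis
    ultimately show "u = v" using e eq by (simp add: prod_eq_iff)
  qed
  moreover have "F ` X \<subseteq> Y"
  proof
    fix z assume "z \<in> F ` X"
    then obtain P M y where z: "z = F ((P, M), y)" and t: "(P, M) \<in> configs n" and y: "y \<in> {1..n} - P"
      and small: "card (P - fst ` M) < k"
      by (force simp: X_def S_def)
    define t' where "t' = (insert y P, {p \<in> M. snd p \<noteq> y})"
    have M: "P \<subseteq> {1..n}" "M \<subseteq> P \<times> ({1..n} - P)" "inj_on fst M" "inj_on snd M"
      using t by (auto simp: configs_def)
    have "t' \<in> configs n"
      using M y unfolding t'_def configs_def
      by (auto intro: inj_on_subset[OF M(3)] inj_on_subset[OF M(4)])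
    moreover have E': "E t' \<subseteq> insert y (insert (slot M y) (P - fst ` M))"
      unfolding E_def t'_def using slot_matched[OF M(4)] by (force simp: image_iff)
    have "card (E t') \<le> k + 1"
    proof -
      have "card (E t') \<le> card (insert y (insert (slot M y) (P - fst ` M)))"
        using configs_finite[OF t] by (intro card_mono E') auto
      also have "\<dots> \<le> Suc (Suc (card (P - fst ` M)))"
        using configs_finite[OF t] by (simp add: card_insert_if)
      finally show ?thesis using small by simp
    qed
    moreover have "y \<in> E t'" using M y unfolding E_def t'_def by auto
    moreover have "slot M y \<in> E t'"
    proof (cases rule: slot_cases[OF t y])
      case 1
      have "slot M y \<notin> fst ` {p \<in> M. snd p \<noteq> y}"
        using inj_onD[OF M(3) _ 1(1)] by force
      then show ?thesis using 1(2) by (simp add: E_def t'_def)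
    next
      case 2
      then show ?thesis using \<open>y \<in> E t'\<close> by simp
    qed
    ultimately show "z \<in> Y" by (simp add: z F_def Y_def t'_def)
  qed
  ultimately have XY: "card X \<le> card Y" using finY by (rule card_inj_on_le)
  have "(n - k) * card S \<le> 2 * card X"
  proof -
    have "n - k \<le> 2 * card ({1..n} - fst t)" if "t \<in> S" for t
    proof -
      have "(fst t, snd t) \<in> configs n" "card (fst t - fst ` snd t) < k" using that by (auto simp: S_def)
      then show ?thesis using configs_card[of "fst t" "snd t" n] by linarith
    qed
    then have "(\<Sum>t\<in>S. n - k) \<le> (\<Sum>t\<in>S. 2 * card ({1..n} - fst t))" by (rule sum_mono)
    also have "\<dots> = 2 * card X" unfolding X_def using finS by (simp add: sum_distrib_left)
    finally show ?thesis by (simp add: mult.commute)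
  qed
  moreover have "card Y \<le> (k + 1)\<^sup>2 * card (configs n)"
  proof -
    let ?T = "{t \<in> configs n. card (E t) \<le> k + 1}"
    have "card Y = (\<Sum>t\<in>?T. card (E t) * card (E t))"
      unfolding Y_def using finite_configs[of n] finE by (subst card_SigmaI) (auto simp: card_cartesian_product)
    also have "\<dots> \<le> (\<Sum>t\<in>?T. (k + 1) * (k + 1))" by (intro sum_mono mult_le_mono) auto
    also have "\<dots> \<le> (\<Sum>t\<in>configs n. (k + 1) * (k + 1))" by (rule sum_mono2) (auto simp: finite_configs)
    finally show ?thesis by (simp add: power2_eq_square mult_ac)
  qed
  ultimately show ?thesis using XY by linarith
qed

lemma card_few_matched:
  fixes k n :: nat
  defines "S \<equiv> {t \<in> configs n. card (snd t) < k \<and> 1 \<le> card (fst t - fst ` snd t) \<and>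
                 1 \<le> card ({1..n} - fst t - snd ` snd t)}"
  shows "(n - 2 * k) * card S \<le> k * card (configs n)"
proof -
  define X where "X = (SIGMA t:S. (fst t - fst ` snd t) \<times> ({1..n} - fst t - snd ` snd t))"
  define Y where "Y = (SIGMA t:{t \<in> configs n. card (snd t) \<le> k}. snd t)"
  define F where "F = (\<lambda>(t :: nat set \<times> (nat \<times> nat) set, p :: nat \<times> nat). ((fst t, insert p (snd t)), p))"
  have finS: "finite S" unfolding S_def using finite_configs[of n] by simp
  have fin: "finite (fst t)" "finite (snd t)" if "t \<in> configs n" for t
    using configs_finite[of "fst t" "snd t" n] that by auto
  have finY: "finite Y" unfolding Y_def using finite_configs[of n] fin by auto
  have "inj_on F X"
  proof (rule inj_onI)
    fix u v assume uv: "u \<in> X" "v \<in> X" "F u = F v"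
    obtain t p t' p' where e: "u = (t, p)" "v = (t', p')" by (metis surj_pair)
    have "p \<notin> snd t" "p' \<notin> snd t'" using uv(1,2) unfolding e X_def by force+
    moreover have "fst t = fst t'" "insert p (snd t) = insert p (snd t')" "p = p'"
      using uv(3) unfolding F_def e by auto
    ultimately show "u = v" using e by (metis insert_ident prod.collapse)
  qed
  moreover have "F ` X \<subseteq> Y"
  proof
    fix z assume "z \<in> F ` X"
    then obtain P M p where z: "z = F ((P, M), p)" and t: "(P, M) \<in> configs n"
      and p: "p \<in> (P - fst ` M) \<times> ({1..n} - P - snd ` M)" and small: "card M < k"
      by (force simp: X_def S_def)
    have "card (insert p M) \<le> k" using small configs_finite[OF t] by (simp add: card_insert_if)
    moreover have "(P, insert p M) \<in> configs n"
    proof -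
      have "fst p \<notin> fst ` M" "snd p \<notin> snd ` M" using p unfolding mem_Times_iff by blast+
      then have "inj_on fst (insert p M)" "inj_on snd (insert p M)"
        using t unfolding configs_def inj_on_insert by blast+
      moreover have "p \<in> P \<times> ({1..n} - P)" using p by blast
      ultimately show ?thesis using t by (simp add: configs_def)
    qed
    ultimately show "z \<in> Y" by (simp add: z F_def Y_def)
  qed
  ultimately have XY: "card X \<le> card Y" using finY by (rule card_inj_on_le)
  have "(n - 2 * k) * card S \<le> card X"
  proof -
    have "n - 2 * k \<le> card ((fst t - fst ` snd t) \<times> ({1..n} - fst t - snd ` snd t))" if "t \<in> S" for t
    proof -
      have mul: "a + b - 1 \<le> a * b" if "1 \<le> a" "1 \<le> b" for a b :: nat
        using that by (cases a; cases b) auto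
      have t: "(fst t, snd t) \<in> configs n" "card (snd t) < k" "1 \<le> card (fst t - fst ` snd t)"
          "1 \<le> card ({1..n} - fst t - snd ` snd t)"
        using that by (auto simp: S_def)
      then show ?thesis
        unfolding card_cartesian_product using configs_card[OF t(1)] mul[OF t(3,4)] by linarith
    qed
    then have "(\<Sum>t\<in>S. n - 2 * k) \<le> (\<Sum>t\<in>S. card ((fst t - fst ` snd t) \<times> ({1..n} - fst t - snd ` snd t)))"
      by (rule sum_mono)
    also have "\<dots> = card X" unfolding X_def using finS fin by (subst card_SigmaI) (auto simp: S_def)
    finally show ?thesis by (simp add: mult.commute)
  qed
  also note XY
  also have "card Y \<le> k * card (configs n)"
  proof -
    let ?T = "{t \<in> configs n. card (snd t) \<le> k}"
    have "card Y = (\<Sum>t\<in>?T. card (snd t))"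
      unfolding Y_def using finite_configs[of n] fin by (subst card_SigmaI) auto
    also have "\<dots> \<le> (\<Sum>t\<in>?T. k)" by (rule sum_mono) simp
    also have "\<dots> \<le> (\<Sum>t\<in>configs n. k)" by (rule sum_mono2) (auto simp: finite_configs)
    finally show ?thesis by (simp add: mult_ac)
  qed
  finally show ?thesis .
qed

lemma card_configs_le:
  assumes "1 \<le> n"
  shows "card (configs n) \<le> 2 * card (labeled class_A n)"
proof -
  let ?f = "\<lambda>t. (cdist n t, 1 \<in> fst t)"
  have "inj_on ?f (configs n)"
  proof (rule inj_onI)
    fix t t' assume a: "t \<in> configs n" "t' \<in> configs n" "?f t = ?f t'"
    obtain P M P' M' where e: "t = (P, M)" "t' = (P', M')" by (metis surj_pair)
    show "t = t'" using cdist_eqD[of P M n P' M'] a assms unfolding e by auto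
  qed
  moreover have "?f ` configs n \<subseteq> labeled class_A n \<times> UNIV" by (auto simp: labeled_eq)
  ultimately have "card (configs n) \<le> card (labeled class_A n \<times> (UNIV :: bool set))"
    using finite_labeled by (intro card_inj_on_le) auto
  then show ?thesis by (simp add: card_cartesian_product)
qed

section \<open>Almost all members are ample\<close>

definition good :: "nat \<Rightarrow> nat \<Rightarrow> (nat set \<times> (nat \<times> nat) set) set" where
  "good k n = {t \<in> configs n. k \<le> card (snd t) \<and> k \<le> card (fst t - fst ` snd t) \<and>
     k \<le> card ({1..n} - fst t - snd ` snd t)}"

lemma models_good:
  assumes \<phi>: "sentence \<phi>" "size \<phi> \<le> k" and t: "t \<in> good k n" "t' \<in> good k n'"
  shows "models {1..n} (cdist n t) \<phi> \<longleftrightarrow> models {1..n'} (cdist n' t') \<phi>"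
proof -
  obtain P M P' M' where e: "t = (P, M)" "t' = (P', M')" by (metis surj_pair)
  let ?B = "slot M ` ({1..n} - P)" and ?B' = "slot M' ` ({1..n'} - P')"
  have c: "(P, M) \<in> configs n" "(P', M') \<in> configs n'" using t by (auto simp: good_def e)
  have "card (fst ` M) = card M" "card (fst ` M') = card M'"
    using c by (auto simp: configs_def card_image)
  then have "ample k P ?B" "ample k P' ?B'"
    using t unfolding ample_def slots[OF c(1) refl] slots[OF c(2) refl] by (simp_all add: good_def e)
  then have "models (gamma_sub P ?B) gamma_dist \<phi> \<longleftrightarrow> models (gamma_sub P' ?B') gamma_dist \<phi>"
    using \<phi> ample_mono by (intro models_gamma_sub) blast+
  then show ?thesis
    using models_isometric[OF \<phi>(1) isometric_gamma_sub[OF c(1)]]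
      models_isometric[OF \<phi>(1) isometric_gamma_sub[OF c(2)]] e by simp
qed

lemma not_good_cases:
  assumes t: "t \<in> configs n" "t \<notin> good k n" and k: "1 \<le> k"
  obtains (unmatched) t' where "t' \<in> configs n" "cdist n t' = cdist n t" "card (fst t' - fst ` snd t') < k"
  | (matched) "card (snd t) < k" "1 \<le> card (fst t - fst ` snd t)" "1 \<le> card ({1..n} - fst t - snd ` snd t)"
proof -
  obtain P M where e: "t = (P, M)" by fastforce
  consider "card (P - fst ` M) < k" | "card ({1..n} - P - snd ` M) < k"
    | "card M < k" "k \<le> card (P - fst ` M)" "k \<le> card ({1..n} - P - snd ` M)"
    using t unfolding good_def e by force
  then show ?thesis
  proof cases
    case 1
    then show ?thesis using unmatched[of t] t(1) e by simp
  next
    case 2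
    have "fst ` (M\<inverse>) = snd ` M" by force
    then show ?thesis using unmatched[of "({1..n} - P, M\<inverse>)"] cdist_swap[of P M n] t(1) 2 e by simp
  next
    case 3
    then show ?thesis using matched k e by simp
  qed
qed

lemma card_labeled_bad:
  assumes k: "1 \<le> k" and n: "4 * k \<le> n"
  shows "n * card (labeled class_A n - cdist n ` good k n)
    \<le> (8 * (k + 1)\<^sup>2 + 4 * k) * card (labeled class_A n)"
proof -
  let ?Sa = "{t \<in> configs n. card (fst t - fst ` snd t) < k}"
  let ?Sm = "{t \<in> configs n. card (snd t) < k \<and> 1 \<le> card (fst t - fst ` snd t) \<and>
                 1 \<le> card ({1..n} - fst t - snd ` snd t)}"
  let ?T = "card (configs n)"
  have bad: "labeled class_A n - cdist n ` good k n \<subseteq> cdist n ` (?Sa \<union> ?Sm)"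
  proof
    fix d assume "d \<in> labeled class_A n - cdist n ` good k n"
    then obtain t where t: "t \<in> configs n" "t \<notin> good k n" "d = cdist n t" by (auto simp: labeled_eq)
    show "d \<in> cdist n ` (?Sa \<union> ?Sm)"
    proof (cases rule: not_good_cases[OF t(1,2) k])
      case (1 t')
      then have "t' \<in> ?Sa \<union> ?Sm" by simp
      then show ?thesis unfolding t(3) 1(2)[symmetric] by (rule imageI)
    next
      case 2
      then have "t \<in> ?Sa \<union> ?Sm" using t(1) by simp
      then show ?thesis unfolding t(3) by (rule imageI)
    qed
  qed
  have "card (labeled class_A n - cdist n ` good k n) \<le> card (?Sa \<union> ?Sm)"
    using finite_configs[of n] by (intro surj_card_le[OF _ bad]) simp
  also have "\<dots> \<le> card ?Sa + card ?Sm" by (rule card_Un_le)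
  finally have "n * card (labeled class_A n - cdist n ` good k n) \<le> n * (card ?Sa + card ?Sm)"
    by (rule mult_le_mono2)
  also have "\<dots> \<le> 2 * ((n - k) * card ?Sa) + 2 * ((n - 2 * k) * card ?Sm)"
  proof -
    have "n * card ?Sa \<le> (2 * (n - k)) * card ?Sa" "n * card ?Sm \<le> (2 * (n - 2 * k)) * card ?Sm"
      using n by (intro mult_le_mono1; linarith)+
    then show ?thesis by (simp add: algebra_simps)
  qed
  also have "\<dots> \<le> 2 * (2 * (k + 1)\<^sup>2 * ?T) + 2 * (k * ?T)"
    by (intro add_mono mult_le_mono2 card_few_unmatched card_few_matched)
  also have "\<dots> = (4 * (k + 1)\<^sup>2 + 2 * k) * ?T" by (simp add: algebra_simps)
  also have "\<dots> \<le> (4 * (k + 1)\<^sup>2 + 2 * k) * (2 * card (labeled class_A n))"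
    using card_configs_le[of n] k n by (intro mult_le_mono2) linarith
  finally show ?thesis by (simp add: algebra_simps)
qed

lemma equiv_isometric: "equiv (labeled K n) (isometric_rel n \<inter> labeled K n \<times> labeled K n)"
proof (rule equivI)
  show "sym (isometric_rel n \<inter> labeled K n \<times> labeled K n)"
    by (rule symI) (auto simp: isometric_rel_def dest: isometric_sym)
  show "trans (isometric_rel n \<inter> labeled K n \<times> labeled K n)"
    by (rule transI) (auto simp: isometric_rel_def dest: isometric_trans)
qed (auto simp: refl_on_def isometric_rel_def isometric_refl)

lemma unlabeledD:
  assumes "C \<in> unlabeled K n"
  shows "C \<subseteq> labeled K n" "C \<noteq> {}" "d \<in> C \<Longrightarrow> d' \<in> C \<Longrightarrow> isometric {1..n} d {1..n} d'"
  using assms in_quotient_imp_subset[OF equiv_isometric] in_quotient_imp_non_empty[OF equiv_isometric]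
    quotient_eq_iff[OF equiv_isometric, of C K n C d d']
  unfolding unlabeled_def by (auto simp: isometric_rel_def)

lemma unlabeled_eqI:
  assumes "C \<in> unlabeled K n" "C' \<in> unlabeled K n" "d \<in> C" "d' \<in> C'" "isometric {1..n} d {1..n} d'"
  shows "C = C'"
  using quotient_eqI[OF equiv_isometric, of C K n C' d d'] unlabeledD(1) assms
  unfolding unlabeled_def isometric_rel_def by blast

lemma unlabeledI:
  assumes "d \<in> labeled K n"
  obtains C where "C \<in> unlabeled K n" "d \<in> C"
  using assms quotientI[OF assms] equiv_class_self[OF equiv_isometric assms] unfolding unlabeled_def by blast

lemma finite_unlabeled: "finite (unlabeled class_A n)"
proof (rule finite_subset)
  show "unlabeled class_A n \<subseteq> Pow (labeled class_A n)" by (intro subsetI PowI unlabeledD(1))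
qed (simp add: finite_labeled)

lemma card_unlabeled_bad:
  assumes k: "1 \<le> k"
  shows "card {C \<in> unlabeled class_A n. C \<inter> cdist n ` good k n = {}} \<le> 2 * k * (n + 1)"
proof -
  let ?B = "{C \<in> unlabeled class_A n. C \<inter> cdist n ` good k n = {}}"
  let ?Q = "\<lambda>C t. t \<in> configs n \<and> cdist n t \<in> C \<and>
    (card (snd t) < k \<or> card (fst t - fst ` snd t) < k)"
  have ex: "\<exists>t. ?Q C t" if C: "C \<in> ?B" for C
  proof -
    have "C \<in> unlabeled class_A n" using C by simp
    from unlabeledD(1,2)[OF this] obtain d where d: "d \<in> C" "d \<in> labeled class_A n" by blast
    then obtain t where t: "t \<in> configs n" "t \<notin> good k n" "d = cdist n t"
      using C by (auto simp: labeled_eq)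
    show ?thesis
    proof (cases rule: not_good_cases[OF t(1,2) k])
      case (1 t')
      then show ?thesis using d(1) t(3) by (intro exI[of _ t']) simp
    next
      case 2
      then show ?thesis using d(1) t(1,3) by (intro exI[of _ t]) simp
    qed
  qed
  define r where "r C = (SOME t. ?Q C t)" for C
  have Q: "?Q C (r C)" if "C \<in> ?B" for C unfolding r_def by (rule someI_ex[OF ex[OF that]])
  have r: "r C \<in> configs n" "cdist n (r C) \<in> C"
      "card (snd (r C)) < k \<or> card (fst (r C) - fst ` snd (r C)) < k" if "C \<in> ?B" for C
    using Q[OF that] by simp_all
  let ?K = "\<lambda>C. (card (snd (r C)), card (fst (r C)))"
  let ?R = "{..<k} \<times> {..n} \<union> (SIGMA m:{..n}. {m..<m + k})"
  have "inj_on ?K ?B"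
  proof (rule inj_onI)
    fix C C' assume C: "C \<in> ?B" "C' \<in> ?B" "?K C = ?K C'"
    then have un: "C \<in> unlabeled class_A n" "C' \<in> unlabeled class_A n" by blast+
    obtain P M P' M' where e: "r C = (P, M)" "r C' = (P', M')" by (metis surj_pair)
    have "isometric {1..n} (cdist n (r C)) {1..n} (cdist n (r C'))"
      using r(1)[OF C(1)] r(1)[OF C(2)] C(3) unfolding e by (intro isometric_cdistI) simp_all
    then show "C = C'" by (rule unlabeled_eqI[OF un r(2)[OF C(1)] r(2)[OF C(2)]])
  qed
  moreover have "?K ` ?B \<subseteq> ?R"
  proof
    fix z assume "z \<in> ?K ` ?B"
    then obtain C where C: "C \<in> ?B" and z: "z = ?K C" by (rule imageE)
    have "(fst (r C), snd (r C)) \<in> configs n" using r(1)[OF C] by simp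
    from configs_card[OF this] show "z \<in> ?R" using r(3)[OF C] unfolding z by auto
  qed
  ultimately have "card ?B \<le> card ?R" by (intro card_inj_on_le) auto
  also have "\<dots> \<le> card ({..<k} \<times> {..n}) + card (SIGMA m:{..n}. {m..<m + k})" by (rule card_Un_le)
  also have "\<dots> = 2 * k * (n + 1)" by (simp add: card_cartesian_product algebra_simps)
  finally show ?thesis .
qed

lemma card_unlabeled_ge: "(n div 4)\<^sup>2 \<le> card (unlabeled class_A n)"
proof -
  define q where "q = n div 4"
  define P where "P = (\<lambda>(m, a). {1..m + a :: nat})"
  define M where "M = (\<lambda>(m, a). (\<lambda>i. (i, m + a + i)) ` {1..m :: nat})"
  have c: "(P z, M z) \<in> configs n" "card (M z) = fst z" "card (P z) = fst z + snd z"
    if "z \<in> {..<q} \<times> {..<q}" for z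
  proof -
    show "(P z, M z) \<in> configs n"
      using that by (auto simp: configs_def P_def M_def q_def inj_on_def split: prod.splits)
    show "card (M z) = fst z"
      unfolding M_def by (cases z) (auto simp: card_image inj_on_def)
    show "card (P z) = fst z + snd z" by (cases z) (simp add: P_def)
  qed
  have "\<exists>C. C \<in> unlabeled class_A n \<and> cdist n (P z, M z) \<in> C" if "z \<in> {..<q} \<times> {..<q}" for z
    using c(1)[OF that] unlabeledI[of "cdist n (P z, M z)" class_A n] by (force simp: labeled_eq)
  then obtain f where f: "\<And>z. z \<in> {..<q} \<times> {..<q} \<Longrightarrow> f z \<in> unlabeled class_A n \<and> cdist n (P z, M z) \<in> f z"
    by metis
  have "inj_on f ({..<q} \<times> {..<q})"
  proof (rule inj_onI)
    fix z z' assume z: "z \<in> {..<q} \<times> {..<q}" "z' \<in> {..<q} \<times> {..<q}" "f z = f z'"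
    then have "isometric {1..n} (cdist n (P z, M z)) {1..n} (cdist n (P z', M z'))"
      using unlabeledD(3) f[OF z(1)] f[OF z(2)] by metis
    from isometric_cdistD[OF c(1)[OF z(1)] c(1)[OF z(2)] this]
    have "fst z' = fst z" "fst z' + snd z' = fst z + snd z \<or> fst z' + snd z' = n - (fst z + snd z)"
      using c(2,3)[OF z(1)] c(2,3)[OF z(2)] by simp_all
    then show "z = z'" using z(1,2) by (auto simp: q_def prod_eq_iff)
  qed
  moreover have "f ` ({..<q} \<times> {..<q}) \<subseteq> unlabeled class_A n" using f by blast
  ultimately have "card ({..<q} \<times> {..<q}) \<le> card (unlabeled class_A n)"
    using finite_unlabeled by (intro card_inj_on_le) auto
  then show ?thesis by (simp add: q_def power2_eq_square)
qed

section \<open>The zero-one laws\<close>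

lemma ratio_null:
  fixes b c :: "nat \<Rightarrow> nat"
  assumes "\<And>n. N \<le> n \<Longrightarrow> n * b n \<le> K * c n"
  shows "(\<lambda>n. real (b n) / real (c n)) \<longlonglongrightarrow> 0"
proof (rule tendsto_sandwich[OF _ _ tendsto_const lim_const_over_n[of "real K"]])
  show "\<forall>\<^sub>F n in sequentially. real (b n) / real (c n) \<le> real K / real n"
    using eventually_ge_at_top[of "max N 1"]
  proof eventually_elim
    case (elim n)
    then have "real n * real (b n) \<le> real K * real (c n)"
      using assms[of n] by (metis max.boundedE of_nat_le_iff of_nat_mult)
    then show ?case using elim by (cases "c n = 0") (auto simp: field_simps)
  qed
qed auto

lemma proportion_limits:
  fixes X B S :: "nat \<Rightarrow> 'a set"
  assumes fin: "\<And>n. finite (X n)" and ne: "\<forall>\<^sub>F n in sequentially. X n \<noteq> {}" and S: "\<And>n. S n \<subseteq> X n"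
    and B: "(\<lambda>n. real (card (B n)) / real (card (X n))) \<longlonglongrightarrow> 0" "\<And>n. B n \<subseteq> X n"
  shows "(\<And>n. X n - B n \<subseteq> S n) \<Longrightarrow> (\<lambda>n. real (card (S n)) / real (card (X n))) \<longlonglongrightarrow> 1"
    and "(\<And>n. S n \<subseteq> B n) \<Longrightarrow> (\<lambda>n. real (card (S n)) / real (card (X n))) \<longlonglongrightarrow> 0"
proof -
  assume XS: "\<And>n. X n - B n \<subseteq> S n"
  have "(\<lambda>n. 1 - real (card (B n)) / real (card (X n))) \<longlonglongrightarrow> 1 - 0" by (intro tendsto_intros B)
  then have lower: "(\<lambda>n. 1 - real (card (B n)) / real (card (X n))) \<longlonglongrightarrow> 1" by simp
  show "(\<lambda>n. real (card (S n)) / real (card (X n))) \<longlonglongrightarrow> 1"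
  proof (rule tendsto_sandwich[OF _ _ lower tendsto_const])
    show "\<forall>\<^sub>F n in sequentially. 1 - real (card (B n)) / real (card (X n)) \<le> real (card (S n)) / real (card (X n))"
      using ne
    proof eventually_elim
      case (elim n)
      have "finite (B n)" "finite (S n)" using finite_subset fin B(2) S by metis+
      then have "card (X n) \<le> card (B n) + card (S n)"
        using XS[of n] card_mono[of "B n \<union> S n" "X n"] card_Un_le[of "B n" "S n"] by force
      moreover have "0 < card (X n)" using elim fin by (simp add: card_gt_0_iff)
      ultimately have "1 \<le> (real (card (B n)) + real (card (S n))) / real (card (X n))"
        by (simp add: pos_le_divide_eq flip: of_nat_add)
      then show ?case by (simp add: add_divide_distrib)
    qed
    show "\<forall>\<^sub>F n in sequentially. real (card (S n)) / real (card (X n)) \<le> 1"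
      using card_mono[OF fin S] by (intro always_eventually) (auto simp: divide_le_eq_1)
  qed
next
  assume SB: "\<And>n. S n \<subseteq> B n"
  show "(\<lambda>n. real (card (S n)) / real (card (X n))) \<longlonglongrightarrow> 0"
  proof (rule tendsto_sandwich[OF _ _ tendsto_const B(1)])
    show "\<forall>\<^sub>F n in sequentially. real (card (S n)) / real (card (X n)) \<le> real (card (B n)) / real (card (X n))"
      using card_mono[OF finite_subset[OF B(2) fin] SB]
      by (intro always_eventually allI divide_right_mono) auto
  qed auto
qed

lemma labeled_bad_null:
  assumes "1 \<le> k"
  shows "(\<lambda>n. real (card (labeled class_A n - cdist n ` good k n)) / real (card (labeled class_A n))) \<longlonglongrightarrow> 0"
  by (rule ratio_null[OF card_labeled_bad[OF assms]])

lemma unlabeled_bad_null: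
  assumes "1 \<le> k"
  shows "(\<lambda>n. real (card {C \<in> unlabeled class_A n. C \<inter> cdist n ` good k n = {}})
    / real (card (unlabeled class_A n))) \<longlonglongrightarrow> 0"
proof (rule ratio_null[of 4 _ "256 * k"])
  fix n :: nat assume n: "4 \<le> n"
  then have div4: "n \<le> 8 * (n div 4)" by presburger
  have "n * card {C \<in> unlabeled class_A n. C \<inter> cdist n ` good k n = {}} \<le> n * (2 * k * (n + 1))"
    by (intro mult_le_mono2 card_unlabeled_bad assms)
  also have "\<dots> \<le> n * (2 * k * (2 * n))" using n by (intro mult_le_mono2) simp
  also have "\<dots> = 4 * k * n\<^sup>2" by (simp add: power2_eq_square)
  also have "\<dots> \<le> 4 * k * (8 * (n div 4))\<^sup>2" by (intro mult_le_mono2 power_mono div4) simp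
  also have "\<dots> = 256 * k * (n div 4)\<^sup>2" by (simp add: power_mult_distrib)
  also have "\<dots> \<le> 256 * k * card (unlabeled class_A n)" by (intro mult_le_mono2 card_unlabeled_ge)
  finally show "n * card {C \<in> unlabeled class_A n. C \<inter> cdist n ` good k n = {}}
    \<le> 256 * k * card (unlabeled class_A n)" .
qed

lemma labeled_ne: "labeled class_A n \<noteq> {}"
  using configs_empty by (auto simp: labeled_eq)

lemma unlabeled_ne: "unlabeled class_A n \<noteq> {}"
  using labeled_ne unlabeledI by blast

lemma proportions_tendsto_1:
  assumes \<phi>: "sentence \<phi>" and k: "1 \<le> k" and m: "\<And>n t. t \<in> good k n \<Longrightarrow> models {1..n} (cdist n t) \<phi>"
  shows "unlabeled_proportion class_A \<phi> \<longlonglongrightarrow> 1" "labeled_proportion class_A \<phi> \<longlonglongrightarrow> 1"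
proof -
  show "labeled_proportion class_A \<phi> \<longlonglongrightarrow> 1"
    unfolding labeled_proportion_def
    using m by (intro proportion_limits(1)[OF _ _ _ labeled_bad_null[OF k]])
      (auto simp: finite_labeled labeled_ne)
  show "unlabeled_proportion class_A \<phi> \<longlonglongrightarrow> 1"
    unfolding unlabeled_proportion_def
  proof (intro proportion_limits(1)[OF _ _ _ unlabeled_bad_null[OF k]])
    fix n
    show "unlabeled class_A n - {C \<in> unlabeled class_A n. C \<inter> cdist n ` good k n = {}}
      \<subseteq> {C \<in> unlabeled class_A n. \<forall>d\<in>C. models {1..n} d \<phi>}"
      using m models_isometric[OF \<phi>] unlabeledD(3)[of _ class_A n] by blast
  qed (auto simp: finite_unlabeled unlabeled_ne)
qed

lemma proportions_tendsto_0:
  assumes k: "1 \<le> k" and m: "\<And>n t. t \<in> good k n \<Longrightarrow> \<not> models {1..n} (cdist n t) \<phi>"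
  shows "unlabeled_proportion class_A \<phi> \<longlonglongrightarrow> 0" "labeled_proportion class_A \<phi> \<longlonglongrightarrow> 0"
proof -
  show "labeled_proportion class_A \<phi> \<longlonglongrightarrow> 0"
    unfolding labeled_proportion_def
    using m by (intro proportion_limits(2)[OF _ _ _ labeled_bad_null[OF k]])
      (auto simp: finite_labeled labeled_ne)
  show "unlabeled_proportion class_A \<phi> \<longlonglongrightarrow> 0"
    unfolding unlabeled_proportion_def
    using m by (intro proportion_limits(2)[OF _ _ _ unlabeled_bad_null[OF k]])
      (auto simp: finite_unlabeled unlabeled_ne)
qed

lemma proportions_zero_one:
  assumes \<phi>: "sentence \<phi>"
  shows "\<exists>l\<in>{0, 1}. unlabeled_proportion class_A \<phi> \<longlonglongrightarrow> l \<and> labeled_proportion class_A \<phi> \<longlonglongrightarrow> l"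
proof (cases "\<forall>n. \<forall>t\<in>good (Suc (size \<phi>)) n. models {1..n} (cdist n t) \<phi>")
  case True
  then show ?thesis using proportions_tendsto_1[OF \<phi>, of "Suc (size \<phi>)"] by auto
next
  case False
  then have "\<not> models {1..n} (cdist n t) \<phi>" if "t \<in> good (Suc (size \<phi>)) n" for n t
    using models_good[OF \<phi> _ that] by (metis le_SucI order_refl)
  then show ?thesis using proportions_tendsto_0[of "Suc (size \<phi>)" \<phi>] by auto
qed

definition unmatched_point :: fm where
  "unmatched_point = Ex 0 (Neg (Ex 1 (Rel R3 0 1)))"

lemma sentence_unmatched_point: "sentence unmatched_point"
  by (auto simp: sentence_def unmatched_point_def)

lemma models_unmatched_point:
  "models M d unmatched_point \<longleftrightarrow> (\<exists>x\<in>M. \<forall>y\<in>M. d x y \<noteq> 3)"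
  by (simp add: models_def unmatched_point_def)

lemma good_unmatched_point:
  assumes "t \<in> good 1 n"
  shows "models {1..n} (cdist n t) unmatched_point"
proof -
  obtain P M where e: "t = (P, M)" by fastforce
  have M: "P \<subseteq> {1..n}" "M \<subseteq> P \<times> ({1..n} - P)" using assms by (auto simp: good_def configs_def e)
  have "P - fst ` M \<noteq> {}" using assms unfolding good_def e by (metis (lifting) card.empty fst_conv snd_conv mem_Collect_eq not_one_le_zero)
  then obtain x where x: "x \<in> P" "x \<notin> fst ` M" by blast
  have "cdist n t x y \<noteq> 3" for y
  proof -
    have "(x, y) \<notin> M" using x(2) by force
    moreover have "(y, x) \<notin> M" using x(1) M(2) by blast
    ultimately show ?thesis by (simp add: cdist_def e)
  qed
  then show ?thesis using x(1) M(1) unfolding models_unmatched_point by blast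
qed

lemma fraisse_limit_matched:
  assumes F: "fraisse_limit class_A M d"
  shows "\<not> models M d unmatched_point"
proof -
  have "({1}, {(1, 2)}) \<in> configs 2" by (auto simp: configs_def)
  then have "class_A {1..2} (cdist 2 ({1}, {(1, 2)}))" by (rule class_A_cdist)
  then obtain E where "E \<subseteq> M" "isometric {1..2} (cdist 2 ({1}, {(1, 2)})) E d"
    using F unfolding fraisse_limit_def by blast
  then obtain f where f: "f ` {1..2} \<subseteq> M"
      "\<And>x y. x \<in> {1..2} \<Longrightarrow> y \<in> {1..2} \<Longrightarrow> d (f x) (f y) = cdist 2 ({1}, {(1, 2)}) x y"
    unfolding isometric_def isometry_def bij_betw_def by blast
  define u v where "u = f 1" and "v = f 2"
  have uv: "u \<in> M" "v \<in> M" "d u v = 3"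
    using f(1) f(2)[of 1 2] by (auto simp: u_def v_def cdist_def)
  have d0: "d z z = 0" if "z \<in> M" for z
    using F that Metric_space.mdist_zero unfolding fraisse_limit_def by metis
  have "\<exists>y\<in>M. d x y = 3" if x: "x \<in> M" for x
  proof -
    have iso: "isometry {u} d ((\<lambda>_. x) ` {u}) d (\<lambda>_. x)"
      using d0 x uv(1) by (simp add: isometry_def bij_betw_def)
    have "homogeneous M d" using F by (simp add: fraisse_limit_def)
    from this[unfolded homogeneous_def, rule_format, of "{u}" "\<lambda>_. x"]
    obtain g where g: "isometry M d M d g" "g u = x" using iso x uv(1) by auto
    then have "d x (g v) = 3" "g v \<in> M"
      using uv unfolding isometry_def bij_betw_def by auto
    then show ?thesis by blast
  qed
  then show ?thesis unfolding models_unmatched_point by blast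
qed

theorem theorem3:
  shows "zero_one_law (unlabeled_proportion class_A) \<and>
         zero_one_law (labeled_proportion class_A) \<and>
         (\<forall>(M :: 'a set) d. fraisse_limit class_A M d \<longrightarrow>
            almost_sure_theory (unlabeled_proportion class_A) \<noteq> complete_theory M d \<and>
            almost_sure_theory (labeled_proportion class_A) \<noteq> complete_theory M d)"
proof (intro conjI allI impI)
  show "zero_one_law (unlabeled_proportion class_A)" "zero_one_law (labeled_proportion class_A)"
    using proportions_zero_one unfolding zero_one_law_def by blast+
  fix M :: "'a set" and d assume "fraisse_limit class_A M d"
  from fraisse_limit_matched[OF this] have "unmatched_point \<notin> complete_theory M d"
    by (simp add: complete_theory_def)
  moreover have "unmatched_point \<in> almost_sure_theory (unlabeled_proportion class_A)"
      "unmatched_point \<in> almost_sure_theory (labeled_proportion class_A)"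
    using proportions_tendsto_1[OF sentence_unmatched_point order_refl good_unmatched_point]
      sentence_unmatched_point by (simp_all add: almost_sure_theory_def)
  ultimately show "almost_sure_theory (unlabeled_proportion class_A) \<noteq> complete_theory M d"
      "almost_sure_theory (labeled_proportion class_A) \<noteq> complete_theory M d"
    by blast+
qed

end
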